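(* Let $D=(0,1)$. Let $\chi_1,\chi_2$ be real-valued functions on $D$ with $M:=\|\chi_1\|_{L^\infty}+\|\chi_2\|_{L^\infty}<\infty$ and $\chi_2(x)>0$ for a.e. $x\in D$, and let $q\in C^1[0,1]$ be real-valued with $Q:=\|q\|_{L^\infty}>0$. Then: (1) There exists a constant $c_Q(\chi_2)>0$, depending only on $Q$ and $\chi_2$, such that if $0\neq\bm{u}\in X_\diamond$ and $\omega\in\mathbb{C}$ with $$0<|\omega|^2\le\frac{c_Q(\chi_2)}{M\,(1+M\|\bm{u}\|_{X_\diamond})},$$ then $T^\diamond_\omega(\bm{u})\neq0$. (2) For any $r>0$ there exists $\delta=\delta(r,Q,M,\chi_2)>0$ such that if $\omega\in\mathbb{C}$ with $0<|\omega|<\delta$ and $\bm{u}\in X_\diamond$ with $0<\|\bm{u}\|_{X_\diamond}<r$, then $T^\diamond_\omega(\bm{u})\neq0$. (3) There exists $\delta>0$ depending only on $q$ such that if $\omega\in(0,\delta]$ and $0\neq\bm{u}=(u_1,u_2)\in X_\diamond$ with $u_1$ real-valued, then $T^\diamond_\omega(\bm{u})\neq0$; moreover, when $q=1$ one can take $\delta=\frac{\pi}{2}$. (For part (3) the assumption on $q$ may be relaxed to: $q\in L^\infty(0,1)$ real-valued.)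
   Context: All functions in $L^2=L^2(0,1)$ and $H^2=H^2(0,1)$ are complex-valued unless stated otherwise. $H^2$ carries the inner product $\langle u,v\rangle_{H^2}=\langle u,v\rangle_{L^2}+\langle u'',v''\rangle_{L^2}$ (its norm is equivalent to the standard one). $H^2_\diamond=\{u\in H^2:u(0)=0\}$ and $X_\diamond=H^2_\diamond\times L^2$, with elements $\bm{u}=(u_1,u_2)$, inner product $\langle\bm{u},\bm{\phi}\rangle_{X_\diamond}=\langle u_1,\phi_1\rangle_{H^2}+\langle u_2,\phi_2\rangle_{L^2}$ and induced norm $\|\cdot\|_{X_\diamond}$. There is a constant $C$ with $\|u/x\|_{L^\infty}\le C\|u\|_{H^2}$ for all $u\in H^2_\diamond$. For $\omega\in\mathbb{C}$, the (nonlinear) operator $T^\diamond_\omega:X_\diamond\to X_\diamond$ is defined via the Riesz representation theorem by requiring, for all $\bm{u},\bm{\phi}\in X_\diamond$, $$\langle T^\diamond_\omega(\bm{u}),\bm{\phi}\rangle_{X_\diamond}=\int_0^1\left[(u_1''+\omega^2qu_1)\overline{\phi}_2+\frac{\omega^2}{x}\chi_1u_2\overline{u}_1\overline{\phi}_2\right]dx+\int_0^1\left[u_2(\overline{\phi}_1''+4\omega^2q\overline{\phi}_1)+\frac{\omega^2}{x}\chi_2u_1^2\overline{\phi}_1\right]dx.$$ *)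

theory Defs
  imports "HOL-Analysis.Analysis" "HOL-Probability.Essential_Supremum"
begin

text \<open>
  Elements of the Lebesgue and Sobolev spaces over the interval \<open>D = (0,1)\<close> are represented by
  functions on the real line, of which only the values on \<open>D\<close> up to null sets matter; equality
  in these spaces is almost-everywhere equality.
\<close>

abbreviation D :: "real measure" where
  "D \<equiv> lebesgue_on {0<..<1}"

subsection \<open>Lebesgue spaces\<close>

definition L2 :: "(real \<Rightarrow> complex) set" where
  "L2 = {f. f \<in> borel_measurable D \<and> integrable D (\<lambda>x. (cmod (f x))\<^sup>2)}"

definition L2_inner :: "(real \<Rightarrow> complex) \<Rightarrow> (real \<Rightarrow> complex) \<Rightarrow> complex" where
  "L2_inner f g = (LINT x|D. f x * cnj (g x))"

text \<open>For non-measurable functions the library's essential supremum is infinite, so membership in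
  \<open>Linf\<close> includes measurability.\<close>

definition Linf :: "(real \<Rightarrow> real) set" where
  "Linf = {f. f \<in> borel_measurable D \<and> esssup D (\<lambda>x. ereal \<bar>f x\<bar>) < \<infinity>}"

definition Linf_norm :: "(real \<Rightarrow> real) \<Rightarrow> real" where
  "Linf_norm f = real_of_ereal (esssup D (\<lambda>x. ereal \<bar>f x\<bar>))"

definition C1_unit :: "(real \<Rightarrow> real) set" where
  "C1_unit = {q. \<exists>q'. continuous_on {0..1} q' \<and>
     (\<forall>x\<in>{0..1}. (q has_real_derivative q' x) (at x within {0..1}))}"

subsection \<open>Sobolev spaces\<close>

text \<open>Smooth test functions with compact support in \<open>(0,1)\<close>. Real-valued ones suffice also for
  weak derivatives of complex-valued functions, by linearity.\<close>

definition test_function :: "(real \<Rightarrow> real) \<Rightarrow> bool" where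
  "test_function \<phi> \<longleftrightarrow>
     (\<forall>k x. (deriv ^^ k) \<phi> field_differentiable at x) \<and>
     (\<exists>K. compact K \<and> K \<subseteq> {0<..<1} \<and> (\<forall>x. x \<notin> K \<longrightarrow> \<phi> x = 0))"

definition has_weak_derivative :: "(real \<Rightarrow> complex) \<Rightarrow> (real \<Rightarrow> complex) \<Rightarrow> bool" where
  "has_weak_derivative f g \<longleftrightarrow>
     (\<forall>\<phi>. test_function \<phi> \<longrightarrow>
        (LINT x|D. f x * of_real (deriv \<phi> x)) = - (LINT x|D. g x * of_real (\<phi> x)))"

definition H1 :: "(real \<Rightarrow> complex) set" where
  "H1 = {f \<in> L2. \<exists>g\<in>L2. has_weak_derivative f g}"

text \<open>A representative of the weak derivative, which is unique up to null sets.\<close>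

definition wderiv :: "(real \<Rightarrow> complex) \<Rightarrow> real \<Rightarrow> complex" where
  "wderiv f = (SOME g. g \<in> L2 \<and> has_weak_derivative f g)"

definition H2 :: "(real \<Rightarrow> complex) set" where
  "H2 = {f \<in> H1. wderiv f \<in> H1}"

definition wderiv2 :: "(real \<Rightarrow> complex) \<Rightarrow> real \<Rightarrow> complex" where
  "wderiv2 f = wderiv (wderiv f)"

definition H2_inner :: "(real \<Rightarrow> complex) \<Rightarrow> (real \<Rightarrow> complex) \<Rightarrow> complex" where
  "H2_inner u v = L2_inner u v + L2_inner (wderiv2 u) (wderiv2 v)"

text \<open>The boundary value at 0 is that of the continuous representative on \<open>[0,1]\<close>.\<close>

definition H2_diamond :: "(real \<Rightarrow> complex) set" where
  "H2_diamond = {u \<in> H2. \<exists>v. continuous_on {0..1} v \<and> (AE x in D. u x = v x) \<and> v 0 = 0}"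

subsection \<open>The product space and the operator\<close>

type_synonym fun_pair = "(real \<Rightarrow> complex) \<times> (real \<Rightarrow> complex)"

definition X_diamond :: "fun_pair set" where
  "X_diamond = H2_diamond \<times> L2"

definition X_inner :: "fun_pair \<Rightarrow> fun_pair \<Rightarrow> complex" where
  "X_inner u \<phi> = H2_inner (fst u) (fst \<phi>) + L2_inner (snd u) (snd \<phi>)"

definition X_norm :: "fun_pair \<Rightarrow> real" where
  "X_norm u = sqrt (Re (X_inner u u))"

definition X_zero :: "fun_pair \<Rightarrow> bool" where
  "X_zero u \<longleftrightarrow> (AE x in D. fst u x = 0) \<and> (AE x in D. snd u x = 0)"

definition T_form ::
  "(real \<Rightarrow> real) \<Rightarrow> (real \<Rightarrow> real) \<Rightarrow> (real \<Rightarrow> real) \<Rightarrow> complex \<Rightarrow> fun_pair \<Rightarrow> fun_pair \<Rightarrow> complex"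
where
  "T_form q \<chi>1 \<chi>2 \<omega> u \<phi> =
     (let u1 = fst u; u2 = snd u; \<phi>1 = fst \<phi>; \<phi>2 = snd \<phi> in
       (LINT x|D. (wderiv2 u1 x + \<omega>\<^sup>2 * of_real (q x) * u1 x) * cnj (\<phi>2 x)
          + \<omega>\<^sup>2 / of_real x * of_real (\<chi>1 x) * u2 x * cnj (u1 x) * cnj (\<phi>2 x))
     + (LINT x|D. u2 x * (cnj (wderiv2 \<phi>1 x) + 4 * \<omega>\<^sup>2 * of_real (q x) * cnj (\<phi>1 x))
          + \<omega>\<^sup>2 / of_real x * of_real (\<chi>2 x) * (u1 x)\<^sup>2 * cnj (\<phi>1 x)))"

text \<open>The Riesz representative of the bounded antilinear functional \<open>T_form q \<chi>1 \<chi>2 \<omega> u\<close>; it is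
  unique up to null sets.\<close>

definition T_diamond ::
  "(real \<Rightarrow> real) \<Rightarrow> (real \<Rightarrow> real) \<Rightarrow> (real \<Rightarrow> real) \<Rightarrow> complex \<Rightarrow> fun_pair \<Rightarrow> fun_pair"
where
  "T_diamond q \<chi>1 \<chi>2 \<omega> u =
     (SOME w. w \<in> X_diamond \<and>
        (\<forall>\<phi>\<in>X_diamond. X_inner w \<phi> = T_form q \<chi>1 \<chi>2 \<omega> u \<phi>))"

end

(* A weak solution u1 is a x plus the twofold primitive of u1'', so everything is phrased through
   iterated primitives, whose adjoints are given by Fubini's theorem. The Riesz representative
   solves a linear fourth-order boundary value problem; in integrated form it is the fixed point of
   a contraction on bounded continuous functions.

   If the operator vanishes at (u1, u2), testing the second component with the function whose second
   derivative is u2 bounds the L^1 norm of u2 by a multiple of |omega|^2 W, W being the integral of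
   chi2 |u1|^2, and testing it with the function x bounds the integral of chi2 u1^2 by a multiple of
   Q times that norm. For real u1 the latter integral is W, which is absurd for small omega. For
   complex u1 the first component shows that u1 is close to a x, so the integral of chi2 u1^2 is close
   to a^2 times that of chi2 x^2, again absurd for small omega. When q = 1 and u1 is real, testing
   with the positive function sin (2 omega x) instead gives u1 = 0, and then u2 solves a homogeneous
   Volterra equation. *)

theory Submission
  imports Defs "HOL-Real_Asymp.Real_Asymp"
begin

section \<open>Square-integrable functions on the unit interval\<close>

text \<open>\<open>T_diamond\<close> is a choice among representatives, so its vanishing says
  something about \<open>T_form\<close> only once a representative is known to exist; this is the
  one purpose of the fourth-order problem. \<open>wderiv\<close> is a choice as well, which is why
  uniqueness of weak derivatives and the passage to primitives precede all estimates.

  The coefficient 1/x is never estimated by itself. Every function of \<open>H2_diamond\<close> is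
  bounded by a multiple of x, so a factor \<open>u1\<close> or the test function absorbs it. The L^1
  norm of \<open>u2\<close> is the natural quantity because it bounds the twofold primitive of
  \<open>u2\<close> pointwise and, the interval having length 1, is itself at most the L^2 norm.

  For complex \<open>u1\<close> the integral of \<open>\<chi>2 u1^2\<close> may vanish by
  cancellation although W does not. The comparison with a x rules this out, at the price of a
  smallness condition that involves \<open>\<chi>1\<close> and the norm of u; for real
  \<open>u1\<close> a constant depending on \<open>q\<close> alone suffices. The second moment of
  \<open>\<chi>2\<close> is the source of the dependence on \<open>\<chi>2\<close>.\<close>

interpretation D: finite_measure D
  by (rule finite_measure_lebesgue_on) auto

lemma measurable_D_id [measurable]: "(\<lambda>x. x) \<in> borel_measurable D"
  by (intro continuous_imp_measurable_on_sets_lebesgue continuous_intros) auto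

lemma borel_measurable_D: "f \<in> borel_measurable borel \<Longrightarrow> f \<in> borel_measurable D"
  using measurable_compose[OF measurable_D_id] by simp

lemma AE_D_neq: "AE x in D. x \<noteq> (a::real)"
proof -
  have "AE x in lebesgue. x \<noteq> a"
    by (rule AE_I'[of "{a}"]) auto
  then show ?thesis
    by (subst AE_restrict_space_iff) auto
qed

lemma AE_D_bounds: "AE x in D. 0 < x \<and> x < 1"
  by (rule AE_I2) auto

lemma integrable_const_D [simp]: "integrable D (\<lambda>x. c :: 'a::{banach, second_countable_topology})"
  by simp

lemma measure_D [simp]: "measure D {0<..<1} = 1"
  by (subst measure_restrict_space) auto

lemma integrable_D_bounded:
  fixes f :: "real \<Rightarrow> 'a::{banach, second_countable_topology}"
  assumes "f \<in> borel_measurable D" "AE x in D. norm (f x) \<le> B"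
  shows "integrable D f"
  using assms by (intro D.integrable_const_bound) auto

lemma L2_measurable [measurable_dest]: "f \<in> L2 \<Longrightarrow> f \<in> borel_measurable D"
  by (simp add: L2_def)

lemma L2_square_integrable: "f \<in> L2 \<Longrightarrow> integrable D (\<lambda>x. (cmod (f x))\<^sup>2)"
  by (simp add: L2_def)

lemma L2_mult_integrable:
  assumes [measurable]: "f \<in> L2" "g \<in> L2"
  shows "integrable D (\<lambda>x. f x * g x)"
proof (rule Bochner_Integration.integrable_bound)
  show "integrable D (\<lambda>x. (cmod (f x))\<^sup>2 + (cmod (g x))\<^sup>2)"
    using assms by (intro Bochner_Integration.integrable_add L2_square_integrable)
  have "cmod (f x * g x) \<le> norm ((cmod (f x))\<^sup>2 + (cmod (g x))\<^sup>2)" for x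
  proof -
    have "2 * (cmod (f x) * cmod (g x)) \<le> (cmod (f x))\<^sup>2 + (cmod (g x))\<^sup>2"
      using sum_squares_bound[of "cmod (f x)" "cmod (g x)"] by (simp add: mult.assoc)
    moreover have "0 \<le> cmod (f x) * cmod (g x)" by simp
    ultimately have "cmod (f x) * cmod (g x) \<le> (cmod (f x))\<^sup>2 + (cmod (g x))\<^sup>2" by linarith
    then show ?thesis by (simp add: norm_mult)
  qed
  then show "AE x in D. cmod (f x * g x) \<le> norm ((cmod (f x))\<^sup>2 + (cmod (g x))\<^sup>2)" by simp
qed measurable

lemma bounded_in_L2:
  assumes [measurable]: "f \<in> borel_measurable D" and b: "AE x in D. cmod (f x) \<le> B"
  shows "f \<in> L2"
proof -
  have "integrable D (\<lambda>x. (cmod (f x))\<^sup>2)"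
  proof (rule integrable_D_bounded[where B = "B\<^sup>2"])
    show "AE x in D. norm ((cmod (f x))\<^sup>2) \<le> B\<^sup>2"
      using b by eventually_elim (auto intro: power_mono)
  qed measurable
  then show ?thesis by (simp add: L2_def)
qed

lemma L2_const [simp]: "(\<lambda>x. c) \<in> L2"
  by (rule bounded_in_L2[where B = "cmod c"]) auto

lemma L2_integrable: "f \<in> L2 \<Longrightarrow> integrable D f"
  using L2_mult_integrable[of f "\<lambda>x. 1"] by simp

lemma L2_cnj [simp]: "(\<lambda>x. cnj (f x)) \<in> L2" if "f \<in> L2"
proof -
  have [measurable]: "cnj \<in> borel_measurable borel"
    by (intro borel_measurable_continuous_onI continuous_intros)
  show ?thesis using that unfolding L2_def by auto
qed

lemma L2_mult_cnj_integrable: "f \<in> L2 \<Longrightarrow> g \<in> L2 \<Longrightarrow> integrable D (\<lambda>x. f x * cnj (g x))"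
  by (intro L2_mult_integrable L2_cnj)

lemma L2_bounded_mult:
  assumes [measurable]: "f \<in> L2" "g \<in> borel_measurable D" and b: "AE x in D. cmod (g x) \<le> B"
  shows "(\<lambda>x. g x * f x) \<in> L2"
proof -
  have "integrable D (\<lambda>x. (cmod (g x * f x))\<^sup>2)"
  proof (rule Bochner_Integration.integrable_bound)
    show "integrable D (\<lambda>x. B\<^sup>2 * (cmod (f x))\<^sup>2)"
      using L2_square_integrable[OF assms(1)] by simp
    show "AE x in D. norm ((cmod (g x * f x))\<^sup>2) \<le> norm (B\<^sup>2 * (cmod (f x))\<^sup>2)"
      using b by eventually_elim (auto simp: norm_mult power_mult_distrib intro!: mult_right_mono power_mono)
  qed measurable
  then show ?thesis by (simp add: L2_def)
qed

lemma L2_cmult [simp]: "f \<in> L2 \<Longrightarrow> (\<lambda>x. c * f x) \<in> L2"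
  by (rule L2_bounded_mult[where B = "cmod c"]) auto

lemma L2_add [simp]:
  assumes [measurable]: "f \<in> L2" "g \<in> L2" shows "(\<lambda>x. f x + g x) \<in> L2"
proof -
  have "integrable D (\<lambda>x. (cmod (f x + g x))\<^sup>2)"
  proof (rule Bochner_Integration.integrable_bound)
    show "integrable D (\<lambda>x. 2 * (cmod (f x))\<^sup>2 + 2 * (cmod (g x))\<^sup>2)"
      using assms by (simp add: L2_square_integrable)
    have "(cmod (f x + g x))\<^sup>2 \<le> 2 * (cmod (f x))\<^sup>2 + 2 * (cmod (g x))\<^sup>2" for x
    proof -
      have "(cmod (f x + g x))\<^sup>2 \<le> (cmod (f x) + cmod (g x))\<^sup>2"
        by (intro power_mono norm_triangle_ineq) auto
      also have "\<dots> \<le> 2 * (cmod (f x))\<^sup>2 + 2 * (cmod (g x))\<^sup>2"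
        using sum_squares_bound[of "cmod (f x)" "cmod (g x)"] by (simp add: power2_sum)
      finally show ?thesis .
    qed
    then show "AE x in D. norm ((cmod (f x + g x))\<^sup>2) \<le> norm (2 * (cmod (f x))\<^sup>2 + 2 * (cmod (g x))\<^sup>2)"
      by simp
  qed measurable
  then show ?thesis by (simp add: L2_def)
qed

lemma L2_diff [simp]: "f \<in> L2 \<Longrightarrow> g \<in> L2 \<Longrightarrow> (\<lambda>x. f x - g x) \<in> L2"
  using L2_add[of f "\<lambda>x. (-1) * g x"] L2_cmult[of g "-1"] by simp

lemma L2_cong_AE:
  assumes [measurable]: "f \<in> borel_measurable D" and ae: "AE x in D. f x = g x" and g[measurable]: "g \<in> L2"
  shows "f \<in> L2"
proof -
  have "integrable D (\<lambda>x. (cmod (f x))\<^sup>2)"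
  proof (rule integrable_cong_AE_imp[OF L2_square_integrable[OF g]])
    show "AE x in D. (cmod (g x))\<^sup>2 = (cmod (f x))\<^sup>2" using ae by eventually_elim simp
  qed measurable
  then show "f \<in> L2" unfolding L2_def using assms(1) by blast
qed

lemma L2_mult_cnj_zero_imp_AE:
  assumes f: "f \<in> L2" and z: "(LINT x|D. f x * cnj (f x)) = 0"
  shows "AE x in D. f x = 0"
proof -
  have "(LINT x|D. f x * cnj (f x)) = (LINT x|D. complex_of_real ((cmod (f x))\<^sup>2))"
    by (simp only: complex_norm_square)
  also have "\<dots> = complex_of_real (LINT x|D. (cmod (f x))\<^sup>2)"
    by (rule integral_of_real[OF L2_square_integrable[OF f]])
  finally have "(LINT x|D. (cmod (f x))\<^sup>2) = 0" using z by simp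
  then have "AE x in D. (cmod (f x))\<^sup>2 = 0"
    by (subst (asm) integral_nonneg_eq_0_iff_AE[OF L2_square_integrable[OF f]]) auto
  then show ?thesis by simp
qed

section \<open>Smooth cut-off functions\<close>

definition smooth :: "(real \<Rightarrow> real) \<Rightarrow> bool" where
  "smooth \<phi> \<longleftrightarrow> (\<forall>k x. (deriv ^^ k) \<phi> field_differentiable at x)"

text \<open>Gives smoothness without a formula for the k-th derivative: it suffices to put the
  function into a class whose members have their derivatives in the class.\<close>

lemma smooth_coinduct:
  assumes "P \<phi>" and step: "\<And>f. P f \<Longrightarrow> \<exists>f'. P f' \<and> (\<forall>x. (f has_real_derivative f' x) (at x))"
  shows "smooth \<phi>"
proof -
  have "P ((deriv ^^ k) \<phi>)" for k
  proof (induction k)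
    case (Suc k)
    then obtain f' where "P f'" and d: "\<forall>x. ((deriv ^^ k) \<phi> has_real_derivative f' x) (at x)"
      using step by blast
    have "deriv ((deriv ^^ k) \<phi>) = f'"
      using d by (intro ext DERIV_imp_deriv) auto
    then show ?case using \<open>P f'\<close> by simp
  qed (use assms in simp)
  then show ?thesis
    unfolding smooth_def using step field_differentiable_def by blast
qed

lemma smooth_has_derivative:
  assumes "smooth f" shows "smooth (deriv f)" "(f has_real_derivative deriv f x) (at x)"
proof -
  have "(deriv ^^ k) (deriv f) = (deriv ^^ Suc k) f" for k
    by (simp only: funpow_Suc_right o_def)
  with assms show "smooth (deriv f)" unfolding smooth_def by metis
  have "f field_differentiable at x" using assms[unfolded smooth_def, rule_format, of 0 x] by simp
  then show "(f has_real_derivative deriv f x) (at x)"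
    by (simp add: DERIV_deriv_iff_field_differentiable)
qed

lemma smooth_isCont: "smooth f \<Longrightarrow> isCont f x"
  using smooth_has_derivative(2) DERIV_isCont by blast

lemma smooth_continuous_on: "smooth f \<Longrightarrow> continuous_on S f"
  by (simp add: continuous_at_imp_continuous_on smooth_isCont)

lemma smooth_linear_combination:
  assumes "smooth f" "smooth g" shows "smooth (\<lambda>x. c * f x + d * g x)"
proof (rule smooth_coinduct[where P = "\<lambda>\<phi>. \<exists>f g. smooth f \<and> smooth g \<and> \<phi> = (\<lambda>x. c * f x + d * g x)"])
  show "\<exists>f'. (\<exists>f g. smooth f \<and> smooth g \<and> f' = (\<lambda>x. c * f x + d * g x)) \<and>
      (\<forall>x. (\<phi> has_real_derivative f' x) (at x))"
    if "\<exists>f g. smooth f \<and> smooth g \<and> \<phi> = (\<lambda>x. c * f x + d * g x)" for \<phi>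
  proof -
    from that obtain f g where fg: "smooth f" "smooth g" "\<phi> = (\<lambda>x. c * f x + d * g x)" by blast
    have "\<forall>x. (\<phi> has_real_derivative (c * deriv f x + d * deriv g x)) (at x)"
      unfolding fg(3) using smooth_has_derivative(2)[OF fg(1)] smooth_has_derivative(2)[OF fg(2)]
      by (intro allI DERIV_add DERIV_cmult)
    then show ?thesis using smooth_has_derivative(1)[OF fg(1)] smooth_has_derivative(1)[OF fg(2)]
      by (intro exI[of _ "\<lambda>x. c * deriv f x + d * deriv g x"]) blast
  qed
qed (use assms in blast)

text \<open>The classical flat function exp(-1/x) divided by a power. The exponent is a parameter
  because differentiation only raises it, by 2 through the exponential and by 1 through the
  power.\<close>

definition flat :: "nat \<Rightarrow> real \<Rightarrow> real" where
  "flat m x = (if x > 0 then exp (- 1 / x) / x ^ m else 0)"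

lemma flat_tendsto_0: "((\<lambda>x. flat m x) \<longlongrightarrow> 0) (at 0)"
proof -
  have "((\<lambda>x::real. exp (- 1 / x) / x ^ m) \<longlongrightarrow> 0) (at_right 0)"
    by real_asymp
  then have "(flat m \<longlongrightarrow> 0) (at_right 0)"
    by (rule Lim_transform_eventually)
      (auto simp: flat_def eventually_at_right_field intro!: exI[of _ 1])
  moreover have "(flat m \<longlongrightarrow> 0) (at_left 0)"
    by (rule tendsto_eventually)
      (auto simp: flat_def eventually_at_left_field intro!: exI[of _ "-1"])
  ultimately show ?thesis
    by (simp add: filterlim_split_at)
qed

lemma flat_has_derivative:
  "(flat m has_real_derivative flat (m + 2) x - real m * flat (m + 1) x) (at x)"
proof (cases "x = 0")
  case True
  \<comment> \<open>At 0 the difference quotient of \<open>flat m\<close> is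
    \<open>flat (m + 1)\<close>, so its limit is another instance of
    \<open>flat_tendsto_0\<close>.\<close>
  have "((\<lambda>h. (flat m h - flat m 0) / h) \<longlongrightarrow> 0) (at 0)"
    using flat_tendsto_0[of "m + 1"]
    by (rule Lim_transform_eventually) (auto simp: flat_def eventually_at intro!: exI[of _ 1])
  then show ?thesis using True by (simp add: DERIV_def flat_def)
next
  case False
  show ?thesis
  proof (cases "x > 0")
    case True
    have "((\<lambda>x. exp (- 1 / x) / x ^ m) has_real_derivative
        flat (m + 2) x - real m * flat (m + 1) x) (at x)"
    proof -
      have e: "((\<lambda>x. exp (- 1 / x)) has_real_derivative exp (- 1 / x) * (1 / x\<^sup>2)) (at x)"
        using True by (auto intro!: derivative_eq_intros simp: power2_eq_square)
      have p: "((\<lambda>x. x ^ m) has_real_derivative real m * x ^ (m - 1)) (at x)"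
        using DERIV_pow[of m x] by simp
      show ?thesis
      proof (rule DERIV_cong[OF DERIV_divide[OF e p]])
        show "(exp (- 1 / x) * (1 / x\<^sup>2) * x ^ m - exp (- 1 / x) * (real m * x ^ (m - 1))) / (x ^ m * x ^ m)
            = flat (m + 2) x - real m * flat (m + 1) x"
          using True by (cases m) (simp_all add: flat_def field_simps power2_eq_square)
      qed (use True in simp)
    qed
    then show ?thesis
      by (rule has_field_derivative_transform_within_open[where S = "{0<..}"])
        (use True in \<open>auto simp: flat_def\<close>)
  next
    case neg: False
    have "((\<lambda>x. 0) has_real_derivative 0) (at x)" by simp
    then have "(flat m has_real_derivative 0) (at x)"
      by (rule has_field_derivative_transform_within_open[where S = "{..<0}"])
        (use neg False in \<open>auto simp: flat_def\<close>)
    then show ?thesis using neg by (simp add: flat_def)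
  qed
qed

text \<open>The span of these products is closed under differentiation.\<close>

inductive flat_span :: "real \<Rightarrow> real \<Rightarrow> real \<Rightarrow> (real \<Rightarrow> real) \<Rightarrow> bool" for n a b where
  prod: "flat_span n a b (\<lambda>x. c * flat m (n * (x - a)) * flat k (n * (b - x)))"
| add: "flat_span n a b f \<Longrightarrow> flat_span n a b g \<Longrightarrow> flat_span n a b (\<lambda>x. f x + g x)"

text \<open>The product rule yields four terms of the generating shape; the inner derivatives n and
  -n go into the scalar factor.\<close>

lemma flat_span_derivative:
  "flat_span n a b f \<Longrightarrow> \<exists>f'. flat_span n a b f' \<and> (\<forall>x. (f has_real_derivative f' x) (at x))"
proof (induction rule: flat_span.induct)
  case (prod c m k)
  have F: "((\<lambda>x. flat m (n * (x - a))) has_real_derivative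
      (flat (m + 2) (n * (x - a)) - real m * flat (m + 1) (n * (x - a))) * n) (at x)" for m :: nat and x
    by (rule DERIV_chain2[OF flat_has_derivative]) (auto intro!: derivative_eq_intros)
  have G: "((\<lambda>x. flat k (n * (b - x))) has_real_derivative
      (flat (k + 2) (n * (b - x)) - real k * flat (k + 1) (n * (b - x))) * (- n)) (at x)" for k :: nat and x
    by (rule DERIV_chain2[OF flat_has_derivative]) (auto intro!: derivative_eq_intros)
  let ?t = "\<lambda>c m k (x::real). c * flat m (n * (x - a)) * flat k (n * (b - x))"
  let ?f' = "\<lambda>x. (?t (c * n) (m + 2) k x + ?t (- c * n * m) (m + 1) k x)
     + (?t (- c * n) m (k + 2) x + ?t (c * n * k) m (k + 1) x)"
  have "flat_span n a b ?f'"
    by (intro flat_span.intros)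
  moreover have "((\<lambda>x. ?t c m k x) has_real_derivative ?f' x) (at x)" for x
    using DERIV_cmult[OF DERIV_mult[OF F[of m x] G[of k x]], of c]
    by (simp add: algebra_simps)
  ultimately show ?case by blast
next
  case (add f g)
  then obtain f' g' where "flat_span n a b f'" "\<forall>x. (f has_real_derivative f' x) (at x)"
    "flat_span n a b g'" "\<forall>x. (g has_real_derivative g' x) (at x)" by blast
  then show ?case
    by (intro exI[of _ "\<lambda>x. f' x + g' x"]) (auto intro: flat_span.intros DERIV_add)
qed

text \<open>A smooth bump on (a, b) whose flanks steepen with n. The factor \<open>Suc n\<close>
  instead of n keeps the bump of index 0 nonzero; that bump serves as the fixed one in
  \<open>du_Bois_Reymond\<close>.\<close>

definition cutoff :: "real \<Rightarrow> real \<Rightarrow> nat \<Rightarrow> real \<Rightarrow> real" where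
  "cutoff a b n x = flat 0 (real (Suc n) * (x - a)) * flat 0 (real (Suc n) * (b - x))"

lemma smooth_cutoff: "smooth (cutoff a b n)"
proof (rule smooth_coinduct[where P = "flat_span (real (Suc n)) a b"])
  show "flat_span (real (Suc n)) a b (cutoff a b n)"
    using flat_span.prod[of "real (Suc n)" a b 1 0 0] by (simp add: cutoff_def[abs_def])
qed (rule flat_span_derivative)

lemma test_function_iff:
  "test_function \<phi> \<longleftrightarrow> smooth \<phi> \<and> (\<exists>K. compact K \<and> K \<subseteq> {0<..<1} \<and> (\<forall>x. x \<notin> K \<longrightarrow> \<phi> x = 0))"
  by (simp add: test_function_def smooth_def)

lemma test_function_cutoff:
  assumes "0 < a" "b < 1" shows "test_function (cutoff a b n)"
  unfolding test_function_iff
  by (intro conjI smooth_cutoff exI[of _ "{a..b}"])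
    (use assms in \<open>auto simp: cutoff_def flat_def zero_less_mult_iff not_less\<close>)

lemma cutoff_bounds: "0 \<le> cutoff a b n x" "cutoff a b n x \<le> 1"
  by (auto simp: cutoff_def flat_def intro!: mult_le_one)

lemma cutoff_pos: "a < x \<Longrightarrow> x < b \<Longrightarrow> 0 < cutoff a b n x"
  by (auto simp: cutoff_def flat_def)

lemma cutoff_tendsto: "(\<lambda>n. cutoff a b n x) \<longlonglongrightarrow> indicator {a<..<b} x"
proof -
  have *: "(\<lambda>n. flat 0 (real (Suc n) * t)) \<longlonglongrightarrow> (if t > 0 then 1 else 0)" for t
  proof (cases "t > 0")
    case True
    have "(\<lambda>n. exp (- 1 / (real (Suc n) * t))) \<longlonglongrightarrow> 1"
      using True by real_asymp
    then show ?thesis using True by (simp add: flat_def)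
  qed (auto simp: flat_def zero_less_mult_iff)
  have "(\<lambda>n. cutoff a b n x) \<longlonglongrightarrow> (if x - a > 0 then 1 else 0) * (if b - x > 0 then 1 else 0)"
    unfolding cutoff_def by (intro tendsto_mult *)
  then show ?thesis by (simp add: indicator_def split: if_splits)
qed


section \<open>Primitives\<close>

text \<open>Truncating the integrand, instead of shrinking the domain, keeps the measure fixed:
  linearity, dominated convergence and Fubini apply directly, and the function is constant to the
  left of 0 and to the right of 1.\<close>

definition primitive :: "(real \<Rightarrow> complex) \<Rightarrow> real \<Rightarrow> complex" where
  "primitive f x = (LINT s|D. (if s < x then f s else 0))"

lemma integrable_if_less:
  fixes f :: "real \<Rightarrow> complex"
  assumes [measurable]: "integrable D f"
  shows "integrable D (\<lambda>s. if s < x then f s else 0)"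
  by (rule Bochner_Integration.integrable_bound[OF assms]) auto

lemma primitive_le_0: "x \<le> 0 \<Longrightarrow> primitive f x = 0"
  unfolding primitive_def
  by (subst Bochner_Integration.integral_cong[where g = "\<lambda>x. 0", OF refl]) auto

lemma primitive_ge_1: "1 \<le> x \<Longrightarrow> primitive f x = (LINT s|D. f s)"
  unfolding primitive_def by (rule Bochner_Integration.integral_cong[OF refl]) auto

lemma primitive_add:
  "integrable D f \<Longrightarrow> integrable D g \<Longrightarrow> primitive (\<lambda>s. f s + g s) x = primitive f x + primitive g x"
  unfolding primitive_def
  by (subst Bochner_Integration.integral_add[symmetric])
    (auto intro: integrable_if_less intro!: Bochner_Integration.integral_cong)

lemma primitive_cmult: "primitive (\<lambda>s. c * f s) x = c * primitive f x"
proof -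
  have "primitive (\<lambda>s. c * f s) x = (LINT s|D. c * (if s < x then f s else 0))"
    unfolding primitive_def by (rule Bochner_Integration.integral_cong) auto
  then show ?thesis by (simp add: primitive_def)
qed

lemma primitive_diff:
  "integrable D f \<Longrightarrow> integrable D g \<Longrightarrow> primitive (\<lambda>s. f s - g s) x = primitive f x - primitive g x"
  using primitive_add[of f "\<lambda>s. (-1) * g s" x] primitive_cmult[of "-1" g x] by simp

lemma primitive_cnj: "primitive (\<lambda>s. cnj (f s)) x = cnj (primitive f x)"
proof -
  have "primitive (\<lambda>s. cnj (f s)) x = (LINT s|D. cnj (if s < x then f s else 0))"
    unfolding primitive_def by (rule Bochner_Integration.integral_cong) auto
  then show ?thesis unfolding primitive_def by simp
qed

lemma primitive_cong_AE:
  assumes [measurable]: "f \<in> borel_measurable D" "g \<in> borel_measurable D"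
    and "AE x in D. f x = g x"
  shows "primitive f = primitive g"
  unfolding primitive_def
  by (rule ext, rule integral_cong_AE) (use assms(3) in auto)

lemma primitive_norm_le:
  assumes "integrable D f" "integrable D g" "AE x in D. cmod (f x) \<le> g x"
  shows "cmod (primitive f x) \<le> (LINT s|D. (if s < x then g s else 0))"
proof -
  have [measurable]: "f \<in> borel_measurable D" "g \<in> borel_measurable D" using assms by auto
  have "cmod (primitive f x) \<le> (LINT s|D. cmod (if s < x then f s else 0))"
    unfolding primitive_def by (rule integral_norm_bound)
  also have "\<dots> \<le> (LINT s|D. (if s < x then g s else 0))"
  proof (rule integral_mono_AE)
    show "integrable D (\<lambda>s. if s < x then g s else 0)"
      by (rule Bochner_Integration.integrable_bound[OF assms(2)]) auto
    show "AE s in D. cmod (if s < x then f s else 0) \<le> (if s < x then g s else 0)"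
      using assms(3) by eventually_elim auto
  qed (use integrable_if_less[OF assms(1)] in auto)
  finally show ?thesis .
qed

lemma primitive_norm_le_integral:
  assumes "integrable D f"
  shows "cmod (primitive f x) \<le> (LINT s|D. cmod (f s))"
proof -
  have "cmod (primitive f x) \<le> (LINT s|D. (if s < x then cmod (f s) else 0))"
    by (rule primitive_norm_le) (use assms in auto)
  also have "\<dots> \<le> (LINT s|D. cmod (f s))"
  proof (rule integral_mono)
    show "integrable D (\<lambda>s. if s < x then cmod (f s) else 0)"
      by (rule Bochner_Integration.integrable_bound[OF assms]) (use assms in auto)
  qed (use assms in auto)
  finally show ?thesis .
qed

text \<open>Dominated convergence along sequences: the truncated integrands converge off the null
  set {x}.\<close>

lemma primitive_isCont:
  assumes f: "integrable D f" shows "isCont (primitive f) x"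
proof -
  have [measurable]: "f \<in> borel_measurable D" using f by auto
  have "(\<lambda>n. primitive f (X n)) \<longlonglongrightarrow> primitive f x" if X: "X \<longlonglongrightarrow> x" for X
    unfolding primitive_def
  proof (rule integral_dominated_convergence[where w = "\<lambda>s. cmod (f s)"])
    show "AE s in D. (\<lambda>n. if s < X n then f s else 0) \<longlonglongrightarrow> (if s < x then f s else 0)"
      using AE_D_neq[of x]
    proof eventually_elim
      fix s assume "s \<noteq> x"
      then consider "s < x" | "s > x" by linarith
      then show "(\<lambda>n. if s < X n then f s else 0) \<longlonglongrightarrow> (if s < x then f s else 0)"
      proof cases
        case 1
        have "\<forall>\<^sub>F n in sequentially. s < X n" using order_tendstoD(1)[OF X 1] .
        then have "\<forall>\<^sub>F n in sequentially. (if s < X n then f s else 0) = (if s < x then f s else 0)"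
          by (rule eventually_mono) (use 1 in auto)
        then show ?thesis by (rule tendsto_eventually)
      next
        case 2
        have "\<forall>\<^sub>F n in sequentially. X n < s" using order_tendstoD(2)[OF X 2] .
        then have "\<forall>\<^sub>F n in sequentially. (if s < X n then f s else 0) = (if s < x then f s else 0)"
          by (rule eventually_mono) (use 2 in auto)
        then show ?thesis by (rule tendsto_eventually)
      qed
    qed
  qed (use f in auto)
  then show ?thesis by (simp add: continuous_at_sequentially o_def)
qed

lemma primitive_continuous_on: "integrable D f \<Longrightarrow> continuous_on S (primitive f)"
  by (simp add: continuous_at_imp_continuous_on primitive_isCont)

lemma primitive_measurable: "integrable D f \<Longrightarrow> primitive f \<in> borel_measurable D"
  by (intro borel_measurable_D borel_measurable_continuous_onI primitive_continuous_on)

lemma primitive_L2: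
  assumes "integrable D f" shows "primitive f \<in> L2"
  by (rule bounded_in_L2[where B = "LINT s|D. cmod (f s)"])
    (use assms in \<open>auto intro!: primitive_measurable AE_I2 primitive_norm_le_integral\<close>)

lemma primitive_integrable: "integrable D f \<Longrightarrow> integrable D (primitive f)"
  by (rule L2_integrable[OF primitive_L2])

lemma continuous_on_L2:
  assumes "continuous_on {0..1} f" shows "f \<in> L2"
proof -
  obtain B where "\<And>x. x \<in> {0..1} \<Longrightarrow> cmod (f x) \<le> B"
    using compact_imp_bounded[OF compact_continuous_image[OF assms compact_Icc]]
    unfolding bounded_iff by blast
  then show ?thesis
    by (intro bounded_in_L2[where B = B] continuous_imp_measurable_on_sets_lebesgue AE_I2)
      (auto intro: continuous_on_subset[OF assms])
qed

text \<open>Evaluates primitives with a known antiderivative, by passing to the gauge integral; the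
  endpoints and the point x do not matter there.\<close>

lemma primitive_FTC:
  assumes F: "\<And>t. t \<in> {0..1} \<Longrightarrow> (F has_vector_derivative f t) (at t within {0..1})"
    and f: "continuous_on {0..1} f" and x: "x \<in> {0..1}"
  shows "primitive f x = F x - F 0"
proof -
  have fD: "integrable D f"
    by (intro L2_integrable continuous_on_L2 f)
  have "primitive f x = integral {0<..<1} (\<lambda>s. if s < x then f s else 0)"
    unfolding primitive_def by (rule lebesgue_integral_eq_integral[OF integrable_if_less[OF fD]]) auto
  also have "\<dots> = integral {0..1} (\<lambda>s. if s < x then f s else 0)"
    by (rule integral_open_interval_real[symmetric])
  also have "\<dots> = integral {0..1} (\<lambda>s. if s \<in> {0..x} then f s else 0)"
    by (rule integral_spike[of "{x}"]) auto
  also have "\<dots> = integral {0..x} f"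
    using x by (subst integral_restrict_Int) (auto simp: Int_absorb1 min_def intro!: arg_cong2[where f = integral])
  also have "\<dots> = F x - F 0"
    using x by (intro integral_unique fundamental_theorem_of_calculus)
      (auto intro!: has_vector_derivative_within_subset[OF F])
  finally show ?thesis .
qed

lemma primitive_const: "x \<in> {0..1} \<Longrightarrow> primitive (\<lambda>s. c) x = c * of_real x"
  by (subst primitive_FTC[where F = "\<lambda>x. c * of_real x"])
    (auto intro!: derivative_eq_intros simp: has_vector_derivative_def scaleR_conv_of_real)

lemma integral_eq_primitive: "(LINT s|D. f s) = primitive f 1"
  by (simp add: primitive_ge_1)

text \<open>Both iterated integrals together cover the unit square up to its diagonal.\<close>

lemma primitive_by_parts:
  assumes f: "integrable D f" and g: "integrable D g"
  shows "(LINT x|D. primitive f x * g x) + (LINT x|D. f x * primitive g x) = (LINT x|D. f x) * (LINT x|D. g x)"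
proof -
  have [measurable]: "f \<in> borel_measurable D" "g \<in> borel_measurable D" using f g by auto
  interpret P: pair_sigma_finite D D ..
  let ?A = "\<lambda>x s. if s < x then f s * g x else 0" and ?B = "\<lambda>x s. if x < s then f s * g x else 0"
  have fg: "integrable (D \<Otimes>\<^sub>M D) (\<lambda>(x, s). f s * g x)"
  proof (rule P.Fubini_integrable)
    show "integrable D (\<lambda>x. LINT y|D. cmod (case (x, y) of (x, s) \<Rightarrow> f s * g x))"
      using f g by (simp add: norm_mult)
  qed (use f in auto)
  have AB: "integrable (D \<Otimes>\<^sub>M D) (case_prod ?A)" "integrable (D \<Otimes>\<^sub>M D) (case_prod ?B)"
    by (rule Bochner_Integration.integrable_bound[OF fg]; auto simp: split_beta')+
  have "primitive f x * g x = (LINT s|D. (?A x s))" for x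
    unfolding primitive_def Bochner_Integration.integral_mult_left_zero[symmetric]
    by (intro Bochner_Integration.integral_cong) auto
  then have "(LINT x|D. primitive f x * g x) = (LINT x|D. LINT s|D. (?A x s))"
    by simp
  moreover have "f s * primitive g s = (LINT x|D. (?B x s))" for s
    unfolding primitive_def Bochner_Integration.integral_mult_right_zero[symmetric]
    by (intro Bochner_Integration.integral_cong) auto
  then have "(LINT x|D. f x * primitive g x) = (LINT s|D. LINT x|D. (?B x s))"
    by simp
  moreover have "(LINT s|D. LINT x|D. (?B x s)) = (LINT x|D. LINT s|D. (?B x s))"
    using P.Fubini_integral[OF AB(2)] by simp
  moreover have "(LINT x|D. LINT s|D. (?A x s)) + (LINT x|D. LINT s|D. (?B x s))
      = (LINT x|D. (LINT s|D. (?A x s)) + (LINT s|D. (?B x s)))"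
    by (rule Bochner_Integration.integral_add[symmetric]) (use P.integrable_fst[OF AB(1)] P.integrable_fst[OF AB(2)] in auto)
  moreover have "(LINT s|D. (?A x s)) + (LINT s|D. (?B x s)) = (LINT s|D. f s) * g x" for x
  proof -
    have "integrable D (\<lambda>s. f s * g x)" using f by simp
    then have "integrable D (?A x)" "integrable D (?B x)"
      by (rule Bochner_Integration.integrable_bound; auto)+
    then have "(LINT s|D. (?A x s)) + (LINT s|D. (?B x s)) = (LINT s|D. (?A x s) + ?B x s)"
      by simp
    also have "\<dots> = (LINT s|D. f s * g x)"
      by (rule integral_cong_AE) (use AE_D_neq[of x] in \<open>auto elim: eventually_mono\<close>)
    finally show ?thesis by simp
  qed
  ultimately show ?thesis by simp
qed

text \<open>The Borel sets over which \<open>f\<close> integrates to 0 form a Dynkin system. It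
  contains the half-lines, which are stable under intersection and generate the Borel sets. A
  Lebesgue set differs from an F-sigma set by a null set, so \<open>f\<close> integrates to 0 over
  every measurable set.\<close>

lemma AE_zero_if_primitive_zero:
  assumes f: "integrable D f" and z: "\<And>x. x \<in> {0..1} \<Longrightarrow> primitive f x = 0"
  shows "AE x in D. f x = 0"
proof (rule D.density_zero[OF f])
  have [measurable]: "f \<in> borel_measurable D" using f by auto
  have z': "primitive f x = 0" for x
    using z[of x] z[of 1] primitive_le_0[of x f] primitive_ge_1[of x f] primitive_ge_1[of 1 f]
    by (cases "x \<in> {0..1}") auto
  let ?I = "\<lambda>A. LINT s|D. (if s \<in> A then f s else 0)"
  have int: "integrable D (\<lambda>s. if s \<in> A then f s else 0)" if "A \<in> sets borel" for A
  proof -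
    have [measurable]: "A \<in> sets borel" using that .
    show ?thesis by (rule Bochner_Integration.integrable_bound[OF f]) auto
  qed
  have borel: "?I A = 0" if A: "A \<in> sets borel" for A
  proof -
    have eq: "sets borel = sigma_sets UNIV (range (\<lambda>x::real. {..<x}))"
      by (simp add: borel_Iio)
    have st: "Int_stable (range (\<lambda>x::real. {..<x}))"
    proof -
      have "{..<a} \<inter> {..<b} = {..<min a b}" for a b :: real by auto
      then show ?thesis by (auto simp: Int_stable_def)
    qed
    from A[unfolded eq] show ?thesis
    proof (induction rule: sigma_sets_induct_disjoint[OF st, of UNIV, simplified, consumes 1, case_names basic empty compl union])
      case (basic A)
      then show ?case using z' by (auto simp: primitive_def)
    next
      case (compl A)
      have "?I (UNIV - A) = (LINT s|D. f s - (if s \<in> A then f s else 0))"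
        by (rule Bochner_Integration.integral_cong) auto
      also have "\<dots> = (LINT s|D. f s) - ?I A"
        by (rule Bochner_Integration.integral_diff[OF f int]) (use compl in \<open>simp add: eq\<close>)
      finally show ?case using compl z'[of 1] by (simp add: primitive_ge_1)
    next
      case (union A)
      have mA: "A i \<in> sets borel" for i using union(2) eq by auto
      have mA': "A i \<inter> {0<..<1} \<in> sets D" for i
        using mA[of i] by (auto simp: sets_restrict_space image_iff intro!: bexI[of _ "A i"])
      have I: "?I B = (LINT s:(B \<inter> {0<..<1})|D. f s)" for B
        unfolding set_lebesgue_integral_def
        by (rule Bochner_Integration.integral_cong) (auto simp: indicator_def)
      have "?I (\<Union>i. A i) = (LINT s:(\<Union>i. A i \<inter> {0<..<1})|D. f s)"
        using I[of "\<Union>i. A i"] by (simp add: Int_UN_distrib2)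
      also have "\<dots> = (\<Sum>i. (LINT s:(A i \<inter> {0<..<1})|D. f s))"
      proof (rule lebesgue_integral_countable_add[OF mA'])
        show "A i \<inter> {0<..<1} \<inter> (A j \<inter> {0<..<1}) = {}" if "i \<noteq> j" for i j
          using union(1) that by (auto simp: disjoint_family_on_def)
        have "(\<Union>i. A i \<inter> {0<..<1}) \<in> sets D" using mA' by (intro sets.countable_UN) blast
        then show "set_integrable D (\<Union>i. A i \<inter> {0<..<1}) f"
          unfolding set_integrable_def using f by (rule integrable_mult_indicator)
      qed
      also have "\<dots> = 0" using union(3) I by simp
      finally show ?case .
    qed auto
  qed
  fix A assume A: "A \<in> sets D"
  then have "A \<in> sets lebesgue" by (auto simp: sets_restrict_space)
  then obtain C T where C: "fsigma C" and T: "T \<in> null_sets lebesgue" and A': "C \<union> T = A"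
    by (rule lebesgue_set_almost_fsigma)
  have [measurable]: "C \<in> sets borel" using C by (auto elim!: fsigma.cases)
  have "AE x in lebesgue. x \<notin> T" using T by (rule AE_not_in)
  then have T': "AE x in D. x \<notin> T"
    by (subst AE_restrict_space_iff) (auto elim: eventually_mono)
  have "set_lebesgue_integral D A f = ?I C"
    unfolding set_lebesgue_integral_def
  proof (rule integral_cong_AE)
    show "AE x in D. indicat_real A x *\<^sub>R f x = (if x \<in> C then f x else 0)"
      using T' by eventually_elim (use A' in \<open>auto simp: indicator_def\<close>)
  qed (use A in \<open>measurable\<close>)
  then show "set_lebesgue_integral D A f = 0" using borel by simp
qed


section \<open>Weak derivatives on the unit interval\<close>

text \<open>The set of agreement is closed and of full measure in (0,1), hence contains it; the
  endpoints follow by continuity. This is what gives boundary values a meaning for functions known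
  only up to null sets.\<close>

lemma continuous_AE_eq:
  fixes f g :: "real \<Rightarrow> complex"
  assumes f: "continuous_on {0..1} f" and g: "continuous_on {0..1} g"
    and ae: "AE x in D. f x = g x" and x: "x \<in> {0..1}"
  shows "f x = g x"
proof -
  let ?h = "\<lambda>x. f x - g x"
  have h: "continuous_on {0..1} ?h" using f g by (intro continuous_intros)
  have "closed {x \<in> {0..1}. ?h x = 0}"
    by (rule continuous_closed_preimage_constant[OF h]) auto
  moreover have "AE x \<in> {0<..<1} in lebesgue. x \<in> {x \<in> {0..1}. ?h x = 0}"
    using ae by (subst (asm) AE_restrict_space_iff) (auto elim: eventually_mono)
  ultimately have "?h x = 0" if "x \<in> {0<..<1}" for x
    using mem_closed_if_AE_lebesgue_open[of "{0<..<1}" "{x \<in> {0..1}. ?h x = 0}" x] that by auto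
  then have "?h x = 0"
    using continuous_constant_on_closure[of "{0<..<1}" ?h 0 x] h x by auto
  then show ?thesis by simp
qed

lemma test_function_properties:
  assumes "test_function \<phi>"
  shows "\<phi> 0 = 0" "\<phi> 1 = 0" "smooth \<phi>"
    "continuous_on S (\<lambda>x. complex_of_real (\<phi> x))"
    "continuous_on S (\<lambda>x. complex_of_real (deriv \<phi> x))"
  using assms by (auto simp: test_function_iff
      intro!: continuous_on_of_real smooth_continuous_on smooth_has_derivative(1))

lemma primitive_deriv_smooth:
  assumes "smooth \<phi>" "x \<in> {0..1}"
  shows "primitive (\<lambda>x. complex_of_real (deriv \<phi> x)) x = complex_of_real (\<phi> x) - complex_of_real (\<phi> 0)"
proof -
  have "((\<lambda>x. complex_of_real (\<phi> x)) has_vector_derivative of_real (deriv \<phi> t)) (at t within {0..1})" for t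
    using smooth_has_derivative(2)[OF assms(1), of t]
    by (intro has_vector_derivative_of_real has_vector_derivative_at_within)
      (simp add: has_real_derivative_iff_has_vector_derivative)
  then show ?thesis
    by (intro primitive_FTC) (use assms in \<open>auto intro!: continuous_on_of_real smooth_continuous_on smooth_has_derivative(1)\<close>)
qed

text \<open>In the integration by parts the boundary product has the integral of the derivative of
  the test function as a factor, and this is 0. The same fact disposes of the constant c.\<close>

lemma has_weak_derivative_primitive:
  assumes g: "integrable D g"
  shows "has_weak_derivative (\<lambda>x. c + primitive g x) g"
  unfolding has_weak_derivative_def
proof (intro allI impI)
  fix \<phi> assume t: "test_function \<phi>"
  let ?d = "\<lambda>x. complex_of_real (deriv \<phi> x)"
  note p = test_function_properties[OF t]
  have L: "?d \<in> L2" by (intro continuous_on_L2 p)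
  have d: "integrable D ?d" by (intro L2_integrable L)
  have prim: "primitive ?d x = \<phi> x" if "x \<in> {0..1}" for x
    using primitive_deriv_smooth[OF p(3) that] p(1) by simp
  have z: "(LINT x|D. ?d x) = 0" unfolding integral_eq_primitive using prim[of 1] p(2) by simp
  have "(LINT x|D. g x * primitive ?d x) = (LINT x|D. g x * \<phi> x)"
    by (rule Bochner_Integration.integral_cong) (auto simp: prim)
  with primitive_by_parts[OF g d] z have "(LINT x|D. primitive g x * ?d x) = - (LINT x|D. g x * \<phi> x)"
    by (simp add: add_eq_0_iff)
  moreover have "(LINT x|D. (c + primitive g x) * ?d x) = (LINT x|D. c * ?d x + primitive g x * ?d x)"
    by (simp add: algebra_simps)
  moreover have "\<dots> = (LINT x|D. c * ?d x) + (LINT x|D. primitive g x * ?d x)"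
    using d L2_mult_integrable[OF primitive_L2[OF g] L] by (intro Bochner_Integration.integral_add) auto
  ultimately show "(LINT x|D. (c + primitive g x) * ?d x) = - (LINT x|D. g x * \<phi> x)"
    using z by simp
qed

section \<open>The fundamental lemma of the calculus of variations and the du Bois-Reymond
  lemma\<close>

text \<open>The cut-offs converge to the indicator of (a, b), so \<open>f\<close> integrates to 0
  over every such interval inside (0,1). Hence the primitive is constant on (0,1), by continuity on
  [0,1], and it is 0 at 0.\<close>

lemma AE_zero_if_orthogonal_test_functions:
  fixes f :: "real \<Rightarrow> complex"
  assumes f: "integrable D f"
    and orth: "\<And>\<psi>. test_function \<psi> \<Longrightarrow> (LINT x|D. f x * of_real (\<psi> x)) = 0"
  shows "AE x in D. f x = 0"
proof -
  have [measurable]: "f \<in> borel_measurable D" using f by auto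
  have eq: "primitive f b = primitive f a" if ab: "0 < a" "a < b" "b < 1" for a b
  proof -
    have [measurable]: "(\<lambda>x. cutoff a b n x) \<in> borel_measurable D" for n
      by (intro borel_measurable_D borel_measurable_continuous_onI smooth_continuous_on smooth_cutoff)
    have "(\<lambda>n. LINT x|D. f x * of_real (cutoff a b n x)) \<longlonglongrightarrow> (LINT x|D. f x * of_real (indicator {a<..<b} x))"
    proof (rule integral_dominated_convergence[where w = "\<lambda>x. cmod (f x)"])
      show "AE x in D. (\<lambda>n. f x * of_real (cutoff a b n x)) \<longlonglongrightarrow> f x * of_real (indicator {a<..<b} x)"
        by (intro AE_I2 tendsto_intros cutoff_tendsto)
      show "AE x in D. cmod (f x * of_real (cutoff a b n x)) \<le> cmod (f x)" for n
        using cutoff_bounds[of a b n] by (intro AE_I2) (simp add: norm_mult mult_left_le)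
    qed (use f in auto)
    moreover have "(LINT x|D. f x * of_real (cutoff a b n x)) = 0" for n
      by (intro orth test_function_cutoff) (use ab in auto)
    ultimately have "0 = (LINT x|D. f x * of_real (indicator {a<..<b} x))"
      by (simp add: LIMSEQ_const_iff)
    \<comment> \<open>The two truncations differ by the indicator of the interval closed at a, hence
      the exception of the single point a.\<close>
    also have "\<dots> = (LINT x|D. (if x < b then f x else 0) - (if x < a then f x else 0))"
      by (rule integral_cong_AE) (use AE_D_neq[of a] ab in \<open>auto elim!: eventually_mono simp: indicator_def\<close>)
    also have "\<dots> = primitive f b - primitive f a"
      unfolding primitive_def by (rule Bochner_Integration.integral_diff) (use f in \<open>auto intro: integrable_if_less\<close>)
    finally show ?thesis by simp
  qed
  have eq': "primitive f x = primitive f (1/2)" if "x \<in> {0<..<1}" for x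
  proof -
    from that have x: "0 < x" "x < 1" by auto
    consider "x < 1/2" | "x = 1/2" | "1/2 < x" by linarith
    then show ?thesis
    proof cases
      case 1
      show ?thesis by (rule eq[symmetric]) (use x 1 in linarith)+
    next
      case 2
      show ?thesis unfolding 2 ..
    next
      case 3
      show ?thesis by (rule eq) (use x 3 in linarith)+
    qed
  qed
  have cl: "primitive f x = primitive f (1/2)" if "x \<in> {0..1}" for x
  proof (rule continuous_constant_on_closure[of "{0<..<1}" "primitive f"])
    show "x \<in> closure {0<..<1}" using that by simp
  qed (fact primitive_continuous_on[OF f] eq')+
  have "primitive f x = 0" if "x \<in> {0..1}" for x
    using trans[OF cl[OF that] cl[of 0, symmetric]] by (simp add: primitive_le_0)
  then show ?thesis by (rule AE_zero_if_primitive_zero[OF f])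
qed

lemma test_function_support:
  assumes "test_function \<psi>"
  obtains a b where "0 < a" "a < b" "b < 1" "\<And>x. x \<notin> {a..b} \<Longrightarrow> \<psi> x = 0"
proof -
  obtain K where K: "compact K" "K \<subseteq> {0<..<1}" "\<And>x. x \<notin> K \<Longrightarrow> \<psi> x = 0"
    using assms by (auto simp: test_function_iff)
  show ?thesis
  proof (cases "K = {}")
    case True
    show ?thesis by (rule that[of "1/3" "1/2"]) (use K True in auto)
  next
    case False
    obtain l where l: "l \<in> K" "\<And>x. x \<in> K \<Longrightarrow> l \<le> x" using compact_attains_inf[OF K(1) False] by blast
    obtain u where u: "u \<in> K" "\<And>x. x \<in> K \<Longrightarrow> x \<le> u" using compact_attains_sup[OF K(1) False] by blast
    have "l \<in> {0<..<1}" "u \<in> {0<..<1}" using K(2) l(1) u(1) by blast+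
    moreover have "l \<le> u" using l u by blast
    \<comment> \<open>The midpoint of the largest support point and 1 keeps the interval
      nondegenerate even if the support set is a single point.\<close>
    ultimately have "0 < l" "l < (u + 1) / 2" "(u + 1) / 2 < 1" "u \<le> (u + 1) / 2" by auto
    then show ?thesis using that[of l "(u + 1) / 2"] K(3) l(2) u(2) by fastforce
  qed
qed

text \<open>The antiderivative normalised to 0 at 0 is constant on both sides of the support of
  \<open>\<psi>\<close>: to the left it has its value at 0, to the right its value at 1, which is
  the mean of \<open>\<psi>\<close> and thus 0.\<close>

lemma test_function_antiderivative:
  assumes \<psi>: "test_function \<psi>" and z: "primitive (\<lambda>x. of_real (\<psi> x)) 1 = 0"
  obtains \<phi> where "test_function \<phi>" "deriv \<phi> = \<psi>"
proof -
  have s: "smooth \<psi>" using \<psi> by (simp add: test_function_iff)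
  obtain a b where ab: "0 < a" "a < b" "b < 1" "\<And>x. x \<notin> {a..b} \<Longrightarrow> \<psi> x = 0"
    by (rule test_function_support[OF \<psi>]) blast
  obtain F where F: "\<And>x. (F has_real_derivative \<psi> x) (at x)"
    using einterval_antiderivative[of "-\<infinity>" "\<infinity>" \<psi>] smooth_isCont[OF s]
    by (auto simp: has_real_derivative_iff_has_vector_derivative)
  define \<phi> where "\<phi> x = F x - F 0" for x
  have d: "(\<phi> has_real_derivative \<psi> x) (at x)" for x
    unfolding \<phi>_def using F by (auto intro!: derivative_eq_intros)
  then have deriv: "deriv \<phi> = \<psi>" by (intro ext DERIV_imp_deriv)
  have smooth: "smooth \<phi>"
    \<comment> \<open>The class consists of \<open>\<phi>\<close> and all smooth functions; the
      derivative of \<open>\<phi>\<close> is the smooth function \<open>\<psi>\<close>.\<close>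
    by (rule smooth_coinduct[where P = "\<lambda>f. f = \<phi> \<or> smooth f"]) (use d s smooth_has_derivative in blast)+
  have "\<phi> 1 = 0"
    using primitive_deriv_smooth[OF smooth, of 1] z by (simp add: deriv \<phi>_def)
  have zero: "\<phi> x = 0" if "x \<notin> {a..b}" for x
  proof (cases "x < a")
    case True
    have "\<phi> constant_on {..<a}"
      by (rule has_field_derivative_0_imp_constant_on[where S = "{..<a}"])
        (use ab d in \<open>fastforce intro: DERIV_cong[OF d]\<close>)+
    then have "\<phi> x = \<phi> 0" using True ab unfolding constant_on_def by auto
    then show ?thesis by (simp add: \<phi>_def)
  next
    case False
    have "\<phi> constant_on {b<..}"
      by (rule has_field_derivative_0_imp_constant_on[where S = "{b<..}"])
        (use ab d in \<open>fastforce intro: DERIV_cong[OF d]\<close>)+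
    then have "\<phi> x = \<phi> 1" using False that ab unfolding constant_on_def by auto
    then show ?thesis using \<open>\<phi> 1 = 0\<close> by simp
  qed
  have "test_function \<phi>"
    unfolding test_function_iff using smooth zero ab by (intro conjI exI[of _ "{a..b}"]) auto
  then show ?thesis using deriv that by blast
qed

lemma integrable_mult_continuous:
  fixes f g :: "real \<Rightarrow> complex"
  assumes f: "integrable D f" and g: "continuous_on {0..1} g"
  shows "integrable D (\<lambda>x. f x * g x)"
proof -
  obtain B where B: "\<And>x. x \<in> {0..1} \<Longrightarrow> cmod (g x) \<le> B"
    using compact_imp_bounded[OF compact_continuous_image[OF g compact_Icc]]
    unfolding bounded_iff by blast
  have [measurable]: "g \<in> borel_measurable D" "f \<in> borel_measurable D"
    using continuous_on_L2[OF g] f by auto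
  show ?thesis
  proof (rule Bochner_Integration.integrable_bound)
    show "integrable D (\<lambda>x. of_real B * f x)" using f by simp
    show "AE x in D. cmod (f x * g x) \<le> cmod (of_real B * f x)"
    proof (rule AE_I2)
      fix x assume "x \<in> space D"
      then have "cmod (g x) \<le> \<bar>B\<bar>" using B[of x] by auto
      then show "cmod (f x * g x) \<le> cmod (of_real B * f x)"
        unfolding norm_mult norm_of_real by (metis mult.commute mult_left_mono norm_ge_zero)
    qed
  qed measurable
qed

text \<open>Subtracting from a test function the multiple of a fixed bump that has the same mean
  leaves the derivative of a test function, against which \<open>f\<close> integrates to 0. The
  constant is therefore the mean of \<open>f\<close> weighted by the bump.\<close>

lemma du_Bois_Reymond:
  fixes f :: "real \<Rightarrow> complex"
  assumes f: "integrable D f"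
    and orth: "\<And>\<phi>. test_function \<phi> \<Longrightarrow> (LINT x|D. f x * of_real (deriv \<phi> x)) = 0"
  shows "\<exists>c. AE x in D. f x = c"
proof -
  have fint: "integrable D (\<lambda>x. f x * of_real (\<psi> x))" if "test_function \<psi>" for \<psi>
    by (intro integrable_mult_continuous f test_function_properties that)
  define \<psi>0 where "\<psi>0 = cutoff (1/4) (3/4) 0"
  have t0: "test_function \<psi>0" unfolding \<psi>0_def by (rule test_function_cutoff) auto
  let ?P = "\<lambda>\<psi>. primitive (\<lambda>x. complex_of_real (\<psi> x)) 1"
  have int: "integrable D (\<lambda>x. complex_of_real (\<psi> x))" if "test_function \<psi>" for \<psi>
    by (intro L2_integrable continuous_on_L2 test_function_properties that)
  have I: "?P \<psi> = of_real (LINT x|D. \<psi> x)" if "test_function \<psi>" for \<psi>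
    by (simp add: integral_eq_primitive[symmetric])
  define m where "m = (LINT x|D. \<psi>0 x)"
  \<comment> \<open>A nonnegative continuous function with integral 0 vanishes everywhere, whereas
    the bump is positive at 1/2.\<close>
  have "m \<noteq> 0"
  proof
    assume "m = 0"
    have i: "integrable D \<psi>0" using int[OF t0] by (simp add: complex_of_real_integrable_eq)
    have "AE x in D. \<psi>0 x = 0"
      using integral_nonneg_eq_0_iff_AE[OF i] \<open>m = 0\<close> unfolding m_def \<psi>0_def by (simp add: cutoff_bounds)
    then have "AE x in D. complex_of_real (\<psi>0 x) = 0" by simp
    from continuous_AE_eq[OF test_function_properties(4)[OF t0] _ this, of "1/2"]
    show False using cutoff_pos[of "1/4" "1/2" "3/4" 0] by (simp add: \<psi>0_def)
  qed
  define c where "c = (LINT x|D. f x * of_real (\<psi>0 x)) / m"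
  have "AE x in D. f x - c = 0"
  proof (rule AE_zero_if_orthogonal_test_functions)
    show "integrable D (\<lambda>x. f x - c)" using f by simp
    fix \<psi> assume t: "test_function \<psi>"
    define k where "k = (LINT x|D. \<psi> x) / m"
    let ?\<theta> = "\<lambda>x. \<psi> x - k * \<psi>0 x"
    have "smooth (\<lambda>x. 1 * \<psi> x + (- k) * \<psi>0 x)"
      by (intro smooth_linear_combination) (use t t0 in \<open>auto simp: test_function_iff\<close>)
    then have "smooth ?\<theta>" by simp
    obtain K0 K where K: "compact K0" "K0 \<subseteq> {0<..<1}" "\<And>x. x \<notin> K0 \<Longrightarrow> \<psi>0 x = 0"
      "compact K" "K \<subseteq> {0<..<1}" "\<And>x. x \<notin> K \<Longrightarrow> \<psi> x = 0"
      using t t0 unfolding test_function_iff by metis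
    have t\<theta>: "test_function ?\<theta>"
      unfolding test_function_iff using K \<open>smooth ?\<theta>\<close>
      by (intro conjI exI[of _ "K0 \<union> K"]) auto
    have ints: "integrable D \<psi>" "integrable D \<psi>0"
      using int[OF t] int[OF t0] by (simp_all add: complex_of_real_integrable_eq)
    have "(LINT x|D. ?\<theta> x) = 0"
      using ints \<open>m \<noteq> 0\<close> by (simp add: k_def m_def)
    then have "?P ?\<theta> = 0" using I[OF t\<theta>] by simp
    then obtain \<phi> where \<phi>: "test_function \<phi>" "deriv \<phi> = ?\<theta>"
      by (rule test_function_antiderivative[OF t\<theta>])
    have "0 = (LINT x|D. f x * of_real (\<psi> x) - of_real k * (f x * of_real (\<psi>0 x)))"
      using orth[OF \<phi>(1)] by (simp add: \<phi>(2) algebra_simps)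
    also have "\<dots> = (LINT x|D. f x * of_real (\<psi> x)) - of_real k * (LINT x|D. f x * of_real (\<psi>0 x))"
      using fint[OF t] fint[OF t0] by simp
    finally have "(LINT x|D. f x * of_real (\<psi> x)) = of_real k * (LINT x|D. f x * of_real (\<psi>0 x))" by simp
    also have "\<dots> = c * of_real (LINT x|D. \<psi> x)" by (simp add: k_def c_def)
    finally have "(LINT x|D. f x * of_real (\<psi> x)) - c * of_real (LINT x|D. \<psi> x) = 0" by simp
    moreover have "(LINT x|D. (f x - c) * of_real (\<psi> x)) = (LINT x|D. f x * of_real (\<psi> x) - c * of_real (\<psi> x))"
      by (simp add: algebra_simps)
    moreover have "\<dots> = (LINT x|D. f x * of_real (\<psi> x)) - c * of_real (LINT x|D. \<psi> x)"
      using fint[OF t] int[OF t] by simp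
    ultimately show "(LINT x|D. (f x - c) * of_real (\<psi> x)) = 0" by simp
  qed
  then show ?thesis by auto
qed

text \<open>The difference of \<open>f\<close> and the primitive of \<open>g\<close> has weak
  derivative 0, so it is constant. From here on test functions are no longer needed.\<close>

lemma has_weak_derivative_iff_primitive:
  assumes f: "integrable D f" and g: "integrable D g"
  shows "has_weak_derivative f g \<longleftrightarrow> (\<exists>c. AE x in D. f x = c + primitive g x)"
proof
  assume w: "has_weak_derivative f g"
  have "\<exists>c. AE x in D. f x - primitive g x = c"
  proof (rule du_Bois_Reymond)
    show "integrable D (\<lambda>x. f x - primitive g x)" using f primitive_integrable[OF g] by simp
    fix \<phi> assume t: "test_function \<phi>"
    let ?d = "\<lambda>x. complex_of_real (deriv \<phi> x)"
    have bint: "integrable D (\<lambda>x. h x * ?d x)" if "integrable D h" for h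
      by (intro integrable_mult_continuous that test_function_properties(5)[OF t])
    have "(LINT x|D. (f x - primitive g x) * ?d x) = (LINT x|D. f x * ?d x - primitive g x * ?d x)"
      by (simp add: algebra_simps)
    also have "\<dots> = (LINT x|D. f x * ?d x) - (LINT x|D. primitive g x * ?d x)"
      using bint[OF f] bint[OF primitive_integrable[OF g]] by simp
    also have "\<dots> = 0"
      using w t has_weak_derivative_primitive[OF g, of 0] unfolding has_weak_derivative_def by simp
    finally show "(LINT x|D. (f x - primitive g x) * ?d x) = 0" .
  qed
  then show "\<exists>c. AE x in D. f x = c + primitive g x"
    by (auto simp: algebra_simps)
next
  assume "\<exists>c. AE x in D. f x = c + primitive g x"
  then obtain c where c: "AE x in D. f x = c + primitive g x" by blast
  have [measurable]: "f \<in> borel_measurable D" "primitive g \<in> borel_measurable D"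
    using f primitive_measurable[OF g] by auto
  show "has_weak_derivative f g"
    unfolding has_weak_derivative_def
  proof (intro allI impI)
    fix \<phi> assume t: "test_function \<phi>"
    have [measurable]: "(\<lambda>x. complex_of_real (deriv \<phi> x)) \<in> borel_measurable D"
      using continuous_on_L2 test_function_properties(5)[OF t] L2_measurable by blast
    have "(LINT x|D. f x * of_real (deriv \<phi> x)) = (LINT x|D. (c + primitive g x) * of_real (deriv \<phi> x))"
      by (rule integral_cong_AE) (use c in \<open>auto elim: eventually_mono\<close>)
    then show "(LINT x|D. f x * of_real (deriv \<phi> x)) = - (LINT x|D. g x * of_real (\<phi> x))"
      using has_weak_derivative_primitive[OF g, of c] t unfolding has_weak_derivative_def by simp
  qed
qed

text \<open>Both primitive representations are continuous, so they agree on all of [0,1]; comparing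
  at 0 identifies the constants, and then the primitive of the difference of the derivatives
  vanishes.\<close>

lemma weak_derivative_unique:
  assumes f: "integrable D f" "integrable D f'" "integrable D g" "integrable D g'"
    and fg: "has_weak_derivative f g" "has_weak_derivative f' g'" and ae: "AE x in D. f x = f' x"
  shows "AE x in D. g x = g' x"
proof -
  obtain c c' where "AE x in D. f x = c + primitive g x" "AE x in D. f' x = c' + primitive g' x"
    using fg f has_weak_derivative_iff_primitive by metis
  then have "AE x in D. c + primitive g x = c' + primitive g' x"
    using ae by eventually_elim simp
  then have eq: "c + primitive g x = c' + primitive g' x" if "x \<in> {0..1}" for x
    by (rule continuous_AE_eq[rotated 2]) (use f that in \<open>auto intro!: continuous_intros primitive_continuous_on\<close>)
  from eq[of 0] have "c = c'" by (simp add: primitive_le_0)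
  have "AE x in D. g x - g' x = 0"
    by (rule AE_zero_if_primitive_zero) (use f eq \<open>c = c'\<close> in \<open>auto simp: primitive_diff\<close>)
  then show ?thesis by simp
qed


section \<open>Sobolev functions as twofold primitives\<close>

lemma wderiv_H1:
  assumes "f \<in> H1"
  shows "f \<in> L2" "wderiv f \<in> L2" "has_weak_derivative f (wderiv f)"
proof -
  from assms have "\<exists>g. g \<in> L2 \<and> has_weak_derivative f g" by (auto simp: H1_def)
  from someI_ex[OF this] show "wderiv f \<in> L2" "has_weak_derivative f (wderiv f)"
    by (auto simp: wderiv_def)
qed (use assms in \<open>auto simp: H1_def\<close>)

text \<open>Uniqueness pins down the chosen representative \<open>wderiv f\<close> up to a null
  set.\<close>

lemma wderiv_eq_AE:
  assumes f: "f \<in> L2" and g: "g \<in> L2" and ae: "AE x in D. f x = c + primitive g x"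
  shows "f \<in> H1" "AE x in D. wderiv f x = g x"
proof -
  have w: "has_weak_derivative f g"
    using has_weak_derivative_iff_primitive[OF L2_integrable[OF f] L2_integrable[OF g]] ae by blast
  then show f': "f \<in> H1" using f g by (auto simp: H1_def)
  show "AE x in D. wderiv f x = g x"
    by (rule weak_derivative_unique[of f f]) (use f g w wderiv_H1[OF f'] in \<open>auto intro: L2_integrable\<close>)
qed

lemma primitive_zero [simp]: "primitive (\<lambda>s. 0) = (\<lambda>x. 0)"
  by (simp add: primitive_def fun_eq_iff)

text \<open>The weak solution of u'' = g on (0,1) with u(0) = 0 and slope b at 0. The pairs (b, g)
  with \<open>g\<close> in \<open>L2\<close> parametrise \<open>H2_diamond\<close>.\<close>

definition primitive2 :: "complex \<Rightarrow> (real \<Rightarrow> complex) \<Rightarrow> real \<Rightarrow> complex" where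
  "primitive2 b g = primitive (\<lambda>s. b + primitive g s)"

lemma primitive2_inner: "g \<in> L2 \<Longrightarrow> (\<lambda>s. b + primitive g s) \<in> L2"
  by (intro L2_add L2_const primitive_L2 L2_integrable)

lemma primitive2_continuous_on: "g \<in> L2 \<Longrightarrow> continuous_on S (primitive2 b g)"
  unfolding primitive2_def by (intro primitive_continuous_on L2_integrable primitive2_inner)

lemma primitive2_L2: "g \<in> L2 \<Longrightarrow> primitive2 b g \<in> L2"
  by (rule continuous_on_L2[OF primitive2_continuous_on])

lemma primitive2_0 [simp]: "primitive2 b g 0 = 0"
  by (simp add: primitive2_def primitive_le_0)

lemma primitive2_eq:
  assumes "g \<in> L2" "x \<in> {0..1}"
  shows "primitive2 b g x = b * of_real x + primitive (primitive g) x"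
  unfolding primitive2_def using assms
  by (subst primitive_add) (auto intro!: L2_integrable primitive_L2 simp: primitive_const)

lemma primitive2_cnj: "g \<in> L2 \<Longrightarrow> primitive2 (cnj b) (\<lambda>x. cnj (g x)) x = cnj (primitive2 b g x)"
  unfolding primitive2_def by (simp add: primitive_cnj flip: complex_cnj_add)

text \<open>Two integrations produce two constants. The continuous representative vanishes at 0,
  which removes the outer one and leaves the slope b.\<close>

lemma H2_diamond_primitive2:
  assumes "u \<in> H2_diamond"
  shows "u \<in> L2" "wderiv2 u \<in> L2" "\<exists>b. AE x in D. u x = primitive2 b (wderiv2 u) x"
proof -
  from assms obtain v where u: "u \<in> H1" "wderiv u \<in> H1"
    and v: "continuous_on {0..1} v" "AE x in D. u x = v x" "v 0 = 0"
    by (auto simp: H2_diamond_def H2_def)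
  note w = wderiv_H1[OF u(1)] wderiv_H1[OF u(2), folded wderiv2_def]
  show "u \<in> L2" "wderiv2 u \<in> L2" by fact+
  obtain c where c: "AE x in D. u x = c + primitive (wderiv u) x"
    using has_weak_derivative_iff_primitive[of u "wderiv u"] w by (auto intro: L2_integrable)
  obtain b where b: "AE x in D. wderiv u x = b + primitive (wderiv2 u) x"
    using has_weak_derivative_iff_primitive[of "wderiv u" "wderiv2 u"] w by (auto intro: L2_integrable)
  have eq: "primitive (wderiv u) = primitive2 b (wderiv2 u)"
    unfolding primitive2_def using w b
    by (intro primitive_cong_AE L2_measurable primitive2_inner)
  have "v 0 = c + primitive2 b (wderiv2 u) 0"
  proof (rule continuous_AE_eq[OF v(1)])
    show "AE x in D. v x = c + primitive2 b (wderiv2 u) x"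
      using c v(2) by eventually_elim (simp add: eq)
  qed (use w in \<open>auto intro!: continuous_intros primitive2_continuous_on\<close>)
  then have "c = 0" using v(3) by simp
  then show "\<exists>b. AE x in D. u x = primitive2 b (wderiv2 u) x"
    using c by (auto simp: eq)
qed

text \<open>The converse, for any measurable function that agrees with the twofold primitive almost
  everywhere, since elements are only determined up to null sets.\<close>

lemma primitive2_H2_diamond:
  assumes u: "u \<in> borel_measurable D" and g: "g \<in> L2" and ae: "AE x in D. u x = primitive2 b g x"
  shows "u \<in> H2_diamond" "AE x in D. wderiv2 u x = g x"
proof -
  have uL: "u \<in> L2" by (rule L2_cong_AE[OF u ae primitive2_L2[OF g]])
  have "AE x in D. u x = 0 + primitive (\<lambda>s. b + primitive g s) x"
    using ae by (simp add: primitive2_def)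
  note 1 = wderiv_eq_AE[OF uL primitive2_inner[OF g] this]
  note 2 = wderiv_eq_AE[OF wderiv_H1(2)[OF 1(1)] g 1(2)]
  show "AE x in D. wderiv2 u x = g x" using 2(2) by (simp add: wderiv2_def)
  show "u \<in> H2_diamond"
    unfolding H2_diamond_def H2_def using 1 2 ae g
    by (auto intro!: exI[of _ "primitive2 b g"] primitive2_continuous_on)
qed

lemma primitive2_in_H2_diamond: "g \<in> L2 \<Longrightarrow> primitive2 b g \<in> H2_diamond"
  and wderiv2_primitive2: "g \<in> L2 \<Longrightarrow> AE x in D. wderiv2 (primitive2 b g) x = g x"
  by (intro primitive2_H2_diamond[of "primitive2 b g" g b] L2_measurable primitive2_L2; simp)+

text \<open>Since \<open>wderiv2\<close> is chosen separately for each function, a null function is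
  not trivially mapped to a null function; uniqueness is what ensures it.\<close>

lemma wderiv2_AE_zero:
  assumes "u \<in> borel_measurable D" "AE x in D. u x = 0"
  shows "AE x in D. wderiv2 u x = 0"
proof (rule primitive2_H2_diamond(2)[OF assms(1)])
  show "AE x in D. u x = primitive2 0 (\<lambda>x. 0) x"
    using assms(2) by (simp add: primitive2_def)
qed simp

section \<open>The Riesz representative\<close>

text \<open>The tail integral from x to 1, the transpose of \<open>primitive\<close> for the
  bilinear pairing on (0,1).\<close>

definition coprimitive :: "(real \<Rightarrow> complex) \<Rightarrow> real \<Rightarrow> complex" where
  "coprimitive f x = (LINT s|D. f s) - primitive f x"

lemma coprimitive_L2: "f \<in> L2 \<Longrightarrow> coprimitive f \<in> L2"
  unfolding coprimitive_def[abs_def] by (intro L2_diff L2_const primitive_L2 L2_integrable)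

lemma coprimitive_continuous_on: "f \<in> L2 \<Longrightarrow> continuous_on S (coprimitive f)"
  unfolding coprimitive_def[abs_def]
  by (intro continuous_intros primitive_continuous_on L2_integrable)

lemma coprimitive_diff:
  assumes "f \<in> L2" "g \<in> L2"
  shows "coprimitive (\<lambda>s. f s - g s) x = coprimitive f x - coprimitive g x"
  using assms by (simp add: coprimitive_def primitive_diff L2_integrable)

lemma coprimitive_cmult: "coprimitive (\<lambda>s. c * f s) x = c * coprimitive f x"
  by (simp add: coprimitive_def primitive_cmult algebra_simps)

lemma coprimitive_by_parts:
  assumes "f \<in> L2" "g \<in> L2"
  shows "(LINT x|D. f x * primitive g x) = (LINT x|D. coprimitive f x * g x)"
proof -
  have "(LINT x|D. coprimitive f x * g x) = (LINT x|D. (LINT s|D. f s) * g x - primitive f x * g x)"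
    by (simp add: coprimitive_def algebra_simps)
  also have "\<dots> = (LINT s|D. f s) * (LINT x|D. g x) - (LINT x|D. primitive f x * g x)"
    using L2_mult_integrable[OF primitive_L2[OF L2_integrable[OF assms(1)]] assms(2)] assms
    by (simp add: L2_integrable)
  finally have *: "(LINT x|D. coprimitive f x * g x)
      = (LINT s|D. f s) * (LINT x|D. g x) - (LINT x|D. primitive f x * g x)" .
  show ?thesis
    unfolding * using primitive_by_parts[OF assms[THEN L2_integrable]]
    by (simp add: eq_diff_eq add.commute)
qed

lemma integral_coprimitive:
  "f \<in> L2 \<Longrightarrow> (LINT x|D. coprimitive f x) = coprimitive (coprimitive f) 0"
  by (simp add: coprimitive_def primitive_le_0)

text \<open>After two transpositions the slope b is paired with the double tail integral at 0, which
  is the first moment of \<open>f\<close>.\<close>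

lemma primitive2_by_parts:
  assumes "f \<in> L2" "g \<in> L2"
  shows "(LINT x|D. f x * primitive2 b g x)
    = b * coprimitive (coprimitive f) 0 + (LINT x|D. coprimitive (coprimitive f) x * g x)"
proof -
  note L = coprimitive_L2[OF assms(1)]
  have "(LINT x|D. f x * primitive2 b g x) = (LINT x|D. coprimitive f x * (b + primitive g x))"
    unfolding primitive2_def by (intro coprimitive_by_parts assms primitive2_inner)
  also have "\<dots> = (LINT x|D. b * coprimitive f x + coprimitive f x * primitive g x)"
    by (simp add: algebra_simps)
  also have "\<dots> = b * (LINT x|D. coprimitive f x) + (LINT x|D. coprimitive f x * primitive g x)"
    using L L2_mult_integrable[OF L primitive_L2[OF L2_integrable[OF assms(2)]]] by (simp add: L2_integrable)
  finally show ?thesis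
    using assms L by (simp add: integral_coprimitive coprimitive_by_parts)
qed

lemma integral_D_ident: "(LINT s|D. s) = 1 / 2"
proof -
  have "complex_of_real (LINT s|D. s) = primitive (\<lambda>s. of_real s) 1"
    by (simp add: primitive_ge_1)
  also have "\<dots> = of_real (1\<^sup>2 / 2) - of_real (0\<^sup>2 / 2)"
  proof (rule primitive_FTC[where F = "\<lambda>x. of_real (x\<^sup>2 / 2)"])
    fix t :: real
    have "((\<lambda>x. x\<^sup>2 / 2) has_real_derivative t) (at t within {0..1})"
      by (auto intro!: derivative_eq_intros)
    then show "((\<lambda>x. complex_of_real (x\<^sup>2 / 2)) has_vector_derivative of_real t) (at t within {0..1})"
      by (intro has_vector_derivative_of_real) (simp add: has_real_derivative_iff_has_vector_derivative)
  qed (auto intro!: continuous_intros)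
  finally show ?thesis by (simp add: complex_eq_iff)
qed

lemma integral_indicator_less: "x \<in> {0..1} \<Longrightarrow> (LINT s|D. (if s < x then B else 0)) = B * (x::real)"
proof -
  assume x: "x \<in> {0..1}"
  have "complex_of_real (LINT s|D. (if s < x then B else 0)) = (LINT s|D. complex_of_real (if s < x then B else 0))"
    by simp
  also have "\<dots> = primitive (\<lambda>s. of_real B) x"
    unfolding primitive_def by (rule Bochner_Integration.integral_cong) auto
  also have "\<dots> = of_real (B * x)" by (simp add: primitive_const[OF x])
  finally show ?thesis unfolding of_real_eq_iff .
qed

lemma primitive_bound:
  assumes "f \<in> L2" "AE s in D. cmod (f s) \<le> B" "x \<in> {0..1}"
  shows "cmod (primitive f x) \<le> B * x"
  using primitive_norm_le[OF L2_integrable[OF assms(1)] _ assms(2), of x] assms(3)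
  by (simp add: integral_indicator_less)

lemma primitive_bound_linear:
  assumes "f \<in> L2" "AE s in D. cmod (f s) \<le> B * s"
  shows "cmod (primitive f x) \<le> B / 2"
proof -
  have "cmod (primitive f x) \<le> (LINT s|D. cmod (f s))"
    by (intro primitive_norm_le_integral L2_integrable assms)
  also have "\<dots> \<le> (LINT s|D. B * s)"
    using assms by (intro integral_mono_AE) (auto intro!: L2_integrable integrable_norm integrable_D_bounded[where B = 1])
  also have "\<dots> = B / 2" by (simp add: integral_D_ident)
  finally show ?thesis .
qed

lemma coprimitive_norm_le:
  assumes f: "f \<in> L2" and g: "integrable D g" and fg: "AE s in D. cmod (f s) \<le> g s"
  shows "cmod (coprimitive f x) \<le> (LINT s|D. g s) - (LINT s|D. (if s < x then g s else 0))"
proof -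
  have [measurable]: "f \<in> borel_measurable D" "g \<in> borel_measurable D" using f g by auto
  have fi: "integrable D f" by (rule L2_integrable[OF f])
  have gi: "integrable D (\<lambda>s. if s < x then g s else 0)"
    by (rule Bochner_Integration.integrable_bound[OF g]) auto
  have "coprimitive f x = (LINT s|D. f s - (if s < x then f s else 0))"
    unfolding coprimitive_def primitive_def using integrable_if_less[OF fi] fi by simp
  also have "cmod \<dots> \<le> (LINT s|D. cmod (f s - (if s < x then f s else 0)))"
    by (rule integral_norm_bound)
  also have "\<dots> \<le> (LINT s|D. g s - (if s < x then g s else 0))"
  proof (rule integral_mono_AE)
    show "AE s in D. cmod (f s - (if s < x then f s else 0)) \<le> g s - (if s < x then g s else 0)"
      using fg by eventually_elim auto
  qed (use fi gi g integrable_if_less[OF fi] in auto)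
  also have "\<dots> = (LINT s|D. g s) - (LINT s|D. (if s < x then g s else 0))"
    using g gi by simp
  finally show ?thesis .
qed

lemma coprimitive_bound:
  assumes "f \<in> L2" "AE s in D. cmod (f s) \<le> B" "x \<in> {0..1}"
  shows "cmod (coprimitive f x) \<le> B * (1 - x)"
  using coprimitive_norm_le[OF assms(1) _ assms(2), of x] assms(3)
  by (simp add: integral_indicator_less algebra_simps)

text \<open>The inner tail integral is at most \<open>B * (1 - s)\<close>, whose integral over (0,1)
  is B/2. The gain of 1/2 is needed for the contraction.\<close>

lemma coprimitive2_bound:
  assumes f: "f \<in> L2" and B: "AE s in D. cmod (f s) \<le> B"
  shows "cmod (coprimitive (coprimitive f) x) \<le> B / 2"
proof -
  have i: "integrable D (\<lambda>s. B * (1 - s))"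
    by (auto intro!: integrable_D_bounded[where B = 1])
  have ae: "AE s in D. cmod (coprimitive f s) \<le> B * (1 - s)"
    by (rule AE_I2) (use coprimitive_bound[OF f B] in auto)
  have B0: "0 \<le> B" using order_trans[OF norm_ge_zero primitive_bound[OF f B, of 1]] by simp
  have "cmod (coprimitive (coprimitive f) x)
      \<le> (LINT s|D. B * (1 - s)) - (LINT s|D. (if s < x then B * (1 - s) else 0))"
    by (rule coprimitive_norm_le[OF coprimitive_L2[OF f] i ae])
  also have "(LINT s|D. (if s < x then B * (1 - s) else 0)) \<ge> 0"
    by (rule integral_nonneg_AE) (use B0 in auto)
  then have "(LINT s|D. B * (1 - s)) - (LINT s|D. (if s < x then B * (1 - s) else 0)) \<le> (LINT s|D. B * (1 - s))"
    by simp
  also have "(LINT s|D. B * (1 - s)) = B / 2"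
  proof -
    have "integrable D (\<lambda>s::real. s)" by (auto intro!: integrable_D_bounded[where B = 1])
    then have "(LINT s|D. 1 - s) = 1 / 2" by (simp add: integral_D_ident)
    then show ?thesis by simp
  qed
  finally show ?thesis .
qed

lemma primitive_minus: "primitive (\<lambda>s. - f s) x = - primitive f x"
  using primitive_cmult[of "-1" f x] by simp

text \<open>Two transpositions turn the pairing of \<open>w - k\<close> with \<open>\<phi>\<close>
  into that of \<open>y\<close> with the second derivative of \<open>\<phi>\<close>. The condition
  \<open>y 0 = 0\<close> removes the term carrying the slope of \<open>\<phi>\<close> at 0, which is
  free in \<open>H2_diamond\<close>. The \<open>y\<close> terms then cancel because
  \<open>wderiv2 w\<close> is \<open>p - y\<close>.\<close>

lemma H2_inner_representation:
  assumes p: "p \<in> L2" and k: "k \<in> L2" and y: "y \<in> L2" and w: "w \<in> L2"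
    and y_def: "\<And>x. x \<in> {0..1} \<Longrightarrow> y x = coprimitive (coprimitive (\<lambda>x. w x - k x)) x" and y0: "y 0 = 0"
    and w2: "w \<in> H2_diamond" "AE x in D. wderiv2 w x = p x - y x" and \<phi>: "\<phi> \<in> H2_diamond"
  shows "H2_inner w \<phi> = (LINT x|D. p x * cnj (wderiv2 \<phi> x)) + (LINT x|D. k x * cnj (\<phi> x))"
proof -
  let ?h = "wderiv2 \<phi>" and ?f = "\<lambda>x. w x - k x"
  obtain a where a: "AE x in D. \<phi> x = primitive2 a ?h x"
    using H2_diamond_primitive2(3)[OF \<phi>] by blast
  have h: "?h \<in> L2" and \<phi>L: "\<phi> \<in> L2" using H2_diamond_primitive2[OF \<phi>] by auto
  have f: "?f \<in> L2" using w k by simp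
  have [measurable]: "wderiv2 w \<in> borel_measurable D"
    by (rule L2_measurable[OF H2_diamond_primitive2(2)[OF w2(1)]])
  have [measurable]: "p \<in> borel_measurable D" "?h \<in> borel_measurable D" "y \<in> borel_measurable D"
    "w \<in> borel_measurable D" "\<phi> \<in> borel_measurable D" "k \<in> borel_measurable D"
    "(\<lambda>x. cnj (?h x)) \<in> borel_measurable D" "(\<lambda>x. cnj (\<phi> x)) \<in> borel_measurable D"
    "(\<lambda>x. cnj (primitive2 a ?h x)) \<in> borel_measurable D"
    using p h y w \<phi>L k by (auto intro!: L2_measurable L2_cnj primitive2_L2)
  have "(LINT x|D. ?f x * cnj (\<phi> x)) = (LINT x|D. ?f x * primitive2 (cnj a) (\<lambda>x. cnj (?h x)) x)"
    by (rule integral_cong_AE) (use a in \<open>auto elim!: eventually_mono simp: primitive2_cnj[OF h]\<close>)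
  also have "\<dots> = cnj a * coprimitive (coprimitive ?f) 0 + (LINT x|D. coprimitive (coprimitive ?f) x * cnj (?h x))"
    by (rule primitive2_by_parts[OF f L2_cnj[OF h]])
  also have "\<dots> = (LINT x|D. y x * cnj (?h x))"
    using y_def[of 0] y0 by (auto intro!: Bochner_Integration.integral_cong simp: y_def)
  finally have eq: "(LINT x|D. ?f x * cnj (\<phi> x)) = (LINT x|D. y x * cnj (?h x))" .
  have 1: "(LINT x|D. ?f x * cnj (\<phi> x)) = (LINT x|D. w x * cnj (\<phi> x)) - (LINT x|D. k x * cnj (\<phi> x))"
    using L2_mult_cnj_integrable[OF w \<phi>L] L2_mult_cnj_integrable[OF k \<phi>L] by (simp add: left_diff_distrib)
  have 2: "L2_inner (wderiv2 w) ?h = (LINT x|D. (p x - y x) * cnj (?h x))"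
    unfolding L2_inner_def
    by (rule integral_cong_AE) (use w2(2) in \<open>auto elim!: eventually_mono\<close>)
  have 3: "(LINT x|D. (p x - y x) * cnj (?h x)) = (LINT x|D. p x * cnj (?h x)) - (LINT x|D. y x * cnj (?h x))"
    using L2_mult_cnj_integrable[OF p h] L2_mult_cnj_integrable[OF y h] by (simp add: left_diff_distrib)
  have "(LINT x|D. w x * cnj (\<phi> x)) = (LINT x|D. y x * cnj (?h x)) + (LINT x|D. k x * cnj (\<phi> x))"
    using trans[OF 1[symmetric] eq] by (simp only: diff_eq_eq)
  then show ?thesis
    unfolding H2_inner_def 2 3 unfolding L2_inner_def by simp
qed

text \<open>Bounded continuous functions are compared on the whole line; this reduces the comparison
  to [0,1].\<close>

lemma primitive_clamp: "primitive f x = primitive f (max 0 (min 1 x))"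
  by (cases "x \<le> 0"; cases "1 \<le> x") (auto simp: primitive_le_0 primitive_ge_1 max_def min_def)

text \<open>In strong form the representative solves \<open>w'' = p - y\<close> and \<open>y'' = w - k\<close> with
  \<open>w(0) = y(0) = y(1) = y'(1) = 0\<close>; the slope of \<open>w\<close> at 0 enforces \<open>y(0) = 0\<close>.\<close>

lemma Riesz_fixed_point:
  assumes p: "p \<in> L2" and k: "k \<in> L2"
  obtains w b where "w \<in> L2"
    "w = primitive2 b (\<lambda>x. p x - coprimitive (coprimitive (\<lambda>x. w x - k x)) x)"
    "coprimitive (coprimitive (\<lambda>x. w x - k x)) 0 = 0"
proof -
  define y where "y w = coprimitive (coprimitive (\<lambda>x. w x - k x))" for w
  define g where "g w = (\<lambda>x. p x - y w x)" for w
  define Y0 where "Y0 f = coprimitive (coprimitive f) 0" for f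
  \<comment> \<open>On [0,1] the function \<open>\<Phi> w\<close> is \<open>b w\<close> times x plus
    \<open>primitive2 0 (g w)\<close>. As \<open>Y0\<close> of x is 1/3, the factor 3 makes
    \<open>Y0\<close> of \<open>\<Phi> w - k\<close> vanish, which at a fixed point is the condition
    y(0) = 0.\<close>
  define b where "b w = 3 * Y0 (\<lambda>x. k x - primitive2 0 (g w) x)" for w
  define \<Phi> where "\<Phi> w = primitive2 (b w) (g w)" for w
  define F where "F W = Bcontfun (\<Phi> (apply_bcontfun W))" for W
  have yL: "y w \<in> L2" if "w \<in> L2" for w
    unfolding y_def using that k by (intro coprimitive_L2 L2_diff)
  have gL: "g w \<in> L2" if "w \<in> L2" for w
    unfolding g_def using that p by (intro yL L2_diff)
  have p0L: "primitive2 0 (g w) \<in> L2" if "w \<in> L2" for w by (intro primitive2_L2 gL that)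
  have Y0_diff: "Y0 (\<lambda>x. f x - h x) = Y0 f - Y0 h" if "f \<in> L2" "h \<in> L2" for f h
  proof -
    have "coprimitive (\<lambda>x. f x - h x) = (\<lambda>x. coprimitive f x - coprimitive h x)"
      using coprimitive_diff[OF that] by (intro ext)
    then show ?thesis unfolding Y0_def by (simp add: coprimitive_diff coprimitive_L2 that)
  qed
  have contL: "apply_bcontfun W \<in> L2" for W :: "real \<Rightarrow>\<^sub>C complex"
    by (rule continuous_on_L2) simp
  have \<Phi>_bcont: "\<Phi> w \<in> bcontfun" if "w \<in> L2" for w
  proof (rule bcontfun_normI)
    show "continuous_on UNIV (\<Phi> w)" unfolding \<Phi>_def by (rule primitive2_continuous_on[OF gL[OF that]])
    show "norm (\<Phi> w x) \<le> (LINT s|D. cmod (b w + primitive (g w) s))" for x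
      unfolding \<Phi>_def primitive2_def
      by (rule primitive_norm_le_integral[OF L2_integrable[OF primitive2_inner[OF gL[OF that]]]])
  qed
  have F: "apply_bcontfun (F W) = \<Phi> (apply_bcontfun W)" for W
    unfolding F_def by (rule Bcontfun_inverse[OF \<Phi>_bcont[OF contL]])
  \<comment> \<open>With \<open>\<delta>\<close> the distance of V and W, the \<open>y\<close> terms
    differ by at most \<delta>/2, the twofold primitive of this difference is at most \<delta>/4,
    and the slopes differ by at most 3 (\<delta>/4)/2. The total 5\<delta>/8 is below the stated
    bound.\<close>
  have lip: "dist (F V) (F W) \<le> (7 / 8) * dist V W" for V W
  proof (rule dist_bound)
    let ?v = "apply_bcontfun V" and ?w = "apply_bcontfun W"
    let ?\<delta> = "dist V W"
    let ?e = "\<lambda>x. y ?v x - y ?w x"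
    note L = contL[of V] contL[of W]
    have eL: "?e \<in> L2" using L by (intro L2_diff yL)
    have "?e x = coprimitive (coprimitive (\<lambda>x. ?v x - ?w x)) x" for x
    proof -
      have "coprimitive (\<lambda>x. ?v x - k x) s - coprimitive (\<lambda>x. ?w x - k x) s = coprimitive (\<lambda>x. ?v x - ?w x) s" for s
        by (subst coprimitive_diff[symmetric]) (use L k in auto)
      moreover have "?e x = coprimitive (\<lambda>s. coprimitive (\<lambda>x. ?v x - k x) s - coprimitive (\<lambda>x. ?w x - k x) s) x"
        unfolding y_def by (subst coprimitive_diff) (use L k in \<open>auto intro: coprimitive_L2\<close>)
      ultimately show ?thesis by simp
    qed
    moreover have "cmod (?v s - ?w s) \<le> ?\<delta>" for s
      using dist_bounded[of V s W] by (simp add: dist_norm)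
    ultimately have e: "cmod (?e x) \<le> ?\<delta> / 2" for x
      using coprimitive2_bound[of "\<lambda>x. ?v x - ?w x" ?\<delta> x] L by simp
    have P: "primitive2 0 (g ?v) x - primitive2 0 (g ?w) x = - primitive (primitive ?e) x" if "x \<in> {0..1}" for x
    proof -
      have "primitive (g ?v) s - primitive (g ?w) s = - primitive ?e s" for s
        unfolding g_def using L p yL by (simp add: primitive_diff L2_integrable)
      then have "primitive (\<lambda>s. primitive (g ?v) s - primitive (g ?w) s) x = - primitive (primitive ?e) x"
        by (simp add: primitive_minus)
      then show ?thesis
        using that gL L by (simp add: primitive2_eq primitive_diff primitive_integrable L2_integrable)
    qed
    have PB: "cmod (primitive (primitive ?e) x) \<le> ?\<delta> / 4" for x
    proof -
      have "cmod (primitive ?e s) \<le> ?\<delta> / 2 * s" if "s \<in> {0..1}" for s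
        by (rule primitive_bound[OF eL _ that]) (use e in simp)
      then have "AE s in D. cmod (primitive ?e s) \<le> ?\<delta> / 2 * s" by (intro AE_I2) simp
      from primitive_bound_linear[OF primitive_L2[OF L2_integrable[OF eL]] this]
      show ?thesis by simp
    qed
    have bd: "cmod (b ?v - b ?w) \<le> 3 / 8 * ?\<delta>"
    proof -
      have "b ?v - b ?w = 3 * Y0 (\<lambda>x. (k x - primitive2 0 (g ?v) x) - (k x - primitive2 0 (g ?w) x))"
        unfolding b_def using L k by (subst Y0_diff) (auto intro!: L2_diff p0L simp: right_diff_distrib)
      moreover have "cmod (Y0 (\<lambda>x. (k x - primitive2 0 (g ?v) x) - (k x - primitive2 0 (g ?w) x))) \<le> (?\<delta> / 4) / 2"
        unfolding Y0_def
      proof (rule coprimitive2_bound)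
        show "AE x in D. cmod (k x - primitive2 0 (g ?v) x - (k x - primitive2 0 (g ?w) x)) \<le> ?\<delta> / 4"
        proof (rule AE_I2)
          fix x assume "x \<in> space D"
          then have x: "x \<in> {0..1}" by simp
          have "k x - primitive2 0 (g ?v) x - (k x - primitive2 0 (g ?w) x) = primitive (primitive ?e) x"
            using P[OF x] by (simp add: algebra_simps)
          then show "cmod (k x - primitive2 0 (g ?v) x - (k x - primitive2 0 (g ?w) x)) \<le> ?\<delta> / 4"
            using PB by simp
        qed
      qed (use L k p0L in auto)
      ultimately show ?thesis by (simp add: norm_mult)
    qed
    have main: "dist (\<Phi> ?v x) (\<Phi> ?w x) \<le> 7 / 8 * ?\<delta>" if x: "x \<in> {0..1}" for x
    proof -
      have "\<Phi> ?v x - \<Phi> ?w x = (b ?v - b ?w) * of_real x + (primitive2 0 (g ?v) x - primitive2 0 (g ?w) x)"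
        unfolding \<Phi>_def using gL L x by (simp add: primitive2_eq algebra_simps)
      also have "\<dots> = (b ?v - b ?w) * of_real x - primitive (primitive ?e) x"
        using P[OF x] by simp
      also have "cmod \<dots> \<le> cmod ((b ?v - b ?w) * of_real x) + cmod (primitive (primitive ?e) x)"
        by (rule norm_triangle_ineq4)
      also have "cmod ((b ?v - b ?w) * of_real x) \<le> cmod (b ?v - b ?w) * 1"
        unfolding norm_mult using x by (intro mult_left_mono) auto
      finally show ?thesis
        unfolding dist_norm[of "\<Phi> ?v x"] using bd PB[of x] zero_le_dist[of V W] by linarith
    qed
    fix x
    have "dist (\<Phi> ?v x) (\<Phi> ?w x) = dist (\<Phi> ?v (max 0 (min 1 x))) (\<Phi> ?w (max 0 (min 1 x)))"
      unfolding \<Phi>_def primitive2_def by (metis primitive_clamp)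
    also have "\<dots> \<le> 7 / 8 * ?\<delta>" by (rule main) auto
    finally show "dist (apply_bcontfun (F V) x) (apply_bcontfun (F W) x) \<le> 7 / 8 * ?\<delta>"
      by (simp add: F)
  qed
  have "\<exists>!W. F W = W"
    by (rule banach_fix_type[where c = "7 / 8"]) (use lip in auto)
  then obtain W where W: "F W = W" by blast
  let ?w = "apply_bcontfun W"
  have wL: "?w \<in> L2" by (rule contL)
  have fixp: "?w = primitive2 (b ?w) (g ?w)" using F[of W] W by (simp add: \<Phi>_def)
  have "y ?w 0 = 0"
  proof -
    let ?x = "primitive2 1 (\<lambda>x. 0)"
    have xL: "?x \<in> L2" by (rule primitive2_L2) simp
    have x: "?x x = of_real x" if "x \<in> {0..1}" for x
      using that by (simp add: primitive2_eq)
    have Y0x: "Y0 (\<lambda>x. c * ?x x) = c / 3" for c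
    proof -
      \<comment> \<open>With slope 1 and second derivative 0 the transposition formula turns
        \<open>Y0\<close> of x into the integral of x^2.\<close>
      have "(LINT s|D. complex_of_real s * ?x s) = 1 * Y0 of_real + (LINT x|D. coprimitive (coprimitive of_real) x * 0)"
        unfolding Y0_def by (rule primitive2_by_parts) (auto intro!: continuous_on_L2 continuous_intros)
      moreover have "(LINT s|D. complex_of_real s * ?x s) = primitive (\<lambda>s. of_real (s\<^sup>2)) 1"
        unfolding integral_eq_primitive[symmetric]
        by (rule Bochner_Integration.integral_cong) (auto simp: x power2_eq_square)
      moreover have "\<dots> = of_real (1^3 / 3) - of_real (0^3 / 3)"
      proof (rule primitive_FTC[where F = "\<lambda>x. of_real (x^3 / 3)"])
        fix t :: real
        have "((\<lambda>x. x^3 / 3) has_real_derivative t\<^sup>2) (at t within {0..1})"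
          by (auto intro!: derivative_eq_intros simp: power2_eq_square)
        then show "((\<lambda>x. complex_of_real (x^3 / 3)) has_vector_derivative of_real (t\<^sup>2)) (at t within {0..1})"
          by (intro has_vector_derivative_of_real) (simp add: has_real_derivative_iff_has_vector_derivative)
      qed (auto intro!: continuous_intros)
      ultimately have 1: "Y0 of_real = 1 / 3" by simp
      have "(LINT s|D. ?x s) = (LINT s|D. complex_of_real s)"
        by (rule Bochner_Integration.integral_cong) (auto simp: x)
      moreover have "primitive ?x = primitive of_real"
        by (rule primitive_cong_AE)
          (auto intro!: L2_measurable xL continuous_on_L2 continuous_intros simp: x)
      ultimately have "coprimitive ?x = coprimitive of_real"
        by (simp add: coprimitive_def fun_eq_iff)
      with 1 have "Y0 ?x = 1 / 3" by (simp add: Y0_def)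
      moreover have "coprimitive (\<lambda>x. c * ?x x) = (\<lambda>x. c * coprimitive ?x x)"
        by (simp add: coprimitive_cmult fun_eq_iff)
      ultimately show ?thesis by (simp add: Y0_def coprimitive_cmult)
    qed
    have "y ?w 0 = Y0 (\<lambda>x. ?w x - k x)" by (simp add: y_def Y0_def)
    also have "(\<lambda>x. ?w x - k x) = (\<lambda>x. b ?w * ?x x - (k x - primitive2 0 (g ?w) x))"
    proof
      fix x
      have "primitive (\<lambda>s. b ?w + primitive (g ?w) s) x = primitive (\<lambda>s. b ?w) x + primitive (primitive (g ?w)) x"
        using gL[OF wL] by (simp add: primitive_add primitive_integrable L2_integrable)
      moreover have "primitive (\<lambda>s. b ?w) x = b ?w * primitive (\<lambda>s. 1) x"
        using primitive_cmult[of "b ?w" "\<lambda>s. 1" x] by simp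
      ultimately have "primitive2 (b ?w) (g ?w) x = b ?w * ?x x + primitive2 0 (g ?w) x"
        by (simp add: primitive2_def)
      then show "?w x - k x = b ?w * ?x x - (k x - primitive2 0 (g ?w) x)"
        by (subst fixp) simp
    qed
    also have "Y0 \<dots> = Y0 (\<lambda>x. b ?w * ?x x) - Y0 (\<lambda>x. k x - primitive2 0 (g ?w) x)"
      by (rule Y0_diff) (use xL k p0L wL in auto)
    also have "\<dots> = 0" by (simp only: Y0x) (simp add: b_def)
    finally show ?thesis .
  qed
  then show ?thesis
    using that[OF wL, of "b ?w"] fixp unfolding g_def y_def by simp
qed

text \<open>Covers the part of \<open>T_form\<close> that depends on \<open>\<phi>1\<close>: there p
  is \<open>u2\<close> and k is the coefficient of the conjugate of \<open>\<phi>1\<close>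
  itself.\<close>

lemma H2_Riesz:
  assumes p: "p \<in> L2" and k: "k \<in> L2"
  shows "\<exists>w\<in>H2_diamond. \<forall>\<phi>\<in>H2_diamond.
    H2_inner w \<phi> = (LINT x|D. p x * cnj (wderiv2 \<phi> x)) + (LINT x|D. k x * cnj (\<phi> x))"
proof -
  obtain w b where w: "w \<in> L2"
    and fixp: "w = primitive2 b (\<lambda>x. p x - coprimitive (coprimitive (\<lambda>x. w x - k x)) x)"
    and y0: "coprimitive (coprimitive (\<lambda>x. w x - k x)) 0 = 0"
    by (rule Riesz_fixed_point[OF p k])
  let ?y = "coprimitive (coprimitive (\<lambda>x. w x - k x))"
  have y: "?y \<in> L2" using w k by (intro coprimitive_L2 L2_diff)
  have g: "(\<lambda>x. p x - ?y x) \<in> L2" using p y by simp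
  have ae: "AE x in D. w x = primitive2 b (\<lambda>x. p x - ?y x) x"
    using fixp by simp
  note H = primitive2_H2_diamond[OF L2_measurable[OF w] g ae]
  show ?thesis
    using H2_inner_representation[OF p k y w refl y0 H] H(1) by blast
qed


section \<open>Essential bounds and the singular factor 1/x\<close>

text \<open>D has positive measure, so the constant 0 has essential supremum 0. This excludes the
  value minus infinity, for which the conversion to a real number in \<open>Linf_norm\<close> would
  be meaningless.\<close>

lemma esssup_abs_nonneg: "f \<in> borel_measurable D \<Longrightarrow> 0 \<le> esssup D (\<lambda>x. ereal \<bar>f x\<bar>)"
proof -
  assume [measurable]: "f \<in> borel_measurable D"
  have "emeasure D (space D) \<noteq> 0"
    by (simp add: D.emeasure_eq_measure)
  then have "0 = esssup D (\<lambda>x. 0 :: ereal)" by (simp add: esssup_const)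
  also have "\<dots> \<le> esssup D (\<lambda>x. ereal \<bar>f x\<bar>)"
    by (rule esssup_mono) auto
  finally show ?thesis .
qed

lemma Linf_measurable [measurable_dest]: "f \<in> Linf \<Longrightarrow> f \<in> borel_measurable D"
  by (simp add: Linf_def)

lemma Linf_norm_nonneg: "f \<in> Linf \<Longrightarrow> 0 \<le> Linf_norm f"
  unfolding Linf_norm_def by (intro real_of_ereal_pos esssup_abs_nonneg Linf_measurable)

lemma Linf_AE_le: "f \<in> Linf \<Longrightarrow> AE x in D. \<bar>f x\<bar> \<le> Linf_norm f"
proof -
  assume f: "f \<in> Linf"
  have "0 \<le> esssup D (\<lambda>x. ereal \<bar>f x\<bar>)" using f by (intro esssup_abs_nonneg Linf_measurable)
  moreover have "esssup D (\<lambda>x. ereal \<bar>f x\<bar>) < \<infinity>" using f by (simp add: Linf_def)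
  ultimately have "esssup D (\<lambda>x. ereal \<bar>f x\<bar>) = ereal (Linf_norm f)"
    unfolding Linf_norm_def by (intro ereal_real'[symmetric]) auto
  with esssup_AE[of "\<lambda>x. ereal \<bar>f x\<bar>" D] show ?thesis by simp
qed

lemma C1_unit_Linf:
  assumes "q \<in> C1_unit" shows "q \<in> Linf"
proof -
  have q: "continuous_on {0..1} q"
    using assms unfolding C1_unit_def by (auto intro: DERIV_continuous_on)
  then obtain B where B: "\<And>x. x \<in> {0..1} \<Longrightarrow> \<bar>q x\<bar> \<le> B"
    using compact_imp_bounded[OF compact_continuous_image[OF q compact_Icc]]
    unfolding bounded_iff real_norm_def by blast
  have [measurable]: "q \<in> borel_measurable D"
    by (rule continuous_imp_measurable_on_sets_lebesgue) (auto intro: continuous_on_subset[OF q])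
  have "esssup D (\<lambda>x. ereal \<bar>q x\<bar>) \<le> ereal B"
    by (rule esssup_I) (use B in auto)
  then show ?thesis by (auto simp: Linf_def)
qed

lemma Linf_mult_integrable:
  fixes f :: "real \<Rightarrow> 'a::{real_normed_field, banach, second_countable_topology}"
  assumes g: "g \<in> Linf" and f: "integrable D f"
  shows "integrable D (\<lambda>x. of_real (g x) * f x)"
proof (rule Bochner_Integration.integrable_bound)
  have [measurable]: "f \<in> borel_measurable D" "g \<in> borel_measurable D" using f g by auto
  show "integrable D (\<lambda>x. of_real (Linf_norm g) * f x)" using f by simp
  show "AE x in D. norm (of_real (g x) * f x) \<le> norm (of_real (Linf_norm g) * f x)"
    using Linf_AE_le[OF g]
  proof eventually_elim
    case (elim x)
    then have "\<bar>g x\<bar> \<le> \<bar>Linf_norm g\<bar>" by simp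
    then show ?case unfolding norm_mult norm_of_real by (rule mult_right_mono) simp
  qed
  show "(\<lambda>x. of_real (g x) * f x) \<in> borel_measurable D" by measurable
qed

lemma Linf_mult_L2:
  assumes g: "g \<in> Linf" and f: "f \<in> L2"
  shows "(\<lambda>x. of_real (g x) * f x) \<in> L2"
proof (rule L2_bounded_mult[where B = "Linf_norm g"])
  show "AE x in D. cmod (complex_of_real (g x)) \<le> Linf_norm g" using Linf_AE_le[OF g] by simp
  have [measurable]: "g \<in> borel_measurable D" using g by auto
  show "(\<lambda>x. complex_of_real (g x)) \<in> borel_measurable D" by measurable
qed (rule f)

text \<open>The variance of \<open>cmod (f x)\<close> is nonnegative, D having total mass 1.\<close>

lemma L2_norm_square_bound:
  assumes f: "f \<in> L2" shows "(LINT x|D. cmod (f x))\<^sup>2 \<le> (LINT x|D. (cmod (f x))\<^sup>2)"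
proof -
  let ?m = "LINT x|D. cmod (f x)"
  have i: "integrable D (\<lambda>x. cmod (f x))" "integrable D (\<lambda>x. (cmod (f x))\<^sup>2)"
    using L2_integrable[OF f] L2_square_integrable[OF f] by auto
  have "0 \<le> (LINT x|D. (cmod (f x) - ?m)\<^sup>2)" by (rule integral_nonneg_AE) simp
  also have "\<dots> = (LINT x|D. (cmod (f x))\<^sup>2 + ?m\<^sup>2 - 2 * ?m * cmod (f x))"
    by (simp add: power2_diff algebra_simps)
  also have "\<dots> = (LINT x|D. (cmod (f x))\<^sup>2) + ?m\<^sup>2 - 2 * ?m * ?m"
    using i by simp
  finally show ?thesis by (simp add: power2_eq_square)
qed

text \<open>The primitive of \<open>g\<close> is bounded by the L^1 norm of \<open>g\<close>, and
  integrating once more yields the factor x that compensates for 1/x. The first bound measures the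
  distance to the linear function b x.\<close>

lemma primitive2_linear_bound:
  assumes g: "g \<in> L2" and x: "x \<in> {0..1}"
  shows "cmod (primitive2 b g x - b * of_real x) \<le> (LINT s|D. cmod (g s)) * x"
    "cmod (primitive2 b g x) \<le> (cmod b + (LINT s|D. cmod (g s))) * x"
proof -
  note L = primitive_L2[OF L2_integrable[OF g]]
  have "cmod (primitive (primitive g) x) \<le> (LINT s|D. cmod (g s)) * x"
    by (rule primitive_bound[OF L _ x]) (intro AE_I2 primitive_norm_le_integral L2_integrable g)
  then show 1: "cmod (primitive2 b g x - b * of_real x) \<le> (LINT s|D. cmod (g s)) * x"
    by (simp add: primitive2_eq[OF g x])
  have "cmod (primitive2 b g x) \<le> cmod (primitive2 b g x - b * of_real x) + cmod (b * of_real x)"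
    using norm_triangle_ineq[of "primitive2 b g x - b * of_real x" "b * of_real x"] by simp
  with 1 x show "cmod (primitive2 b g x) \<le> (cmod b + (LINT s|D. cmod (g s))) * x"
    by (simp add: norm_mult algebra_simps)
qed

lemma H2_diamond_linear_bound:
  assumes "u \<in> H2_diamond" obtains S where "0 \<le> S" "AE x in D. cmod (u x) \<le> S * x"
proof -
  obtain b where b: "AE x in D. u x = primitive2 b (wderiv2 u) x"
    using H2_diamond_primitive2(3)[OF assms] by blast
  have "AE x in D. cmod (u x) \<le> (cmod b + (LINT s|D. cmod (wderiv2 u s))) * x"
    using b AE_D_bounds
    by eventually_elim (use primitive2_linear_bound(2)[OF H2_diamond_primitive2(2)[OF assms]] in auto)
  then show ?thesis by (rule that[rotated]) simp
qed

text \<open>Since \<open>u\<close> is bounded by a multiple of x, the quotient u/x is a bounded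
  multiplier of \<open>L2\<close>.\<close>

lemma H2_diamond_divide_mult_L2:
  assumes u: "u \<in> H2_diamond" and f: "f \<in> L2"
  shows "(\<lambda>x. u x / of_real x * f x) \<in> L2"
proof -
  obtain S where S: "0 \<le> S" "AE x in D. cmod (u x) \<le> S * x" by (rule H2_diamond_linear_bound[OF u])
  have [measurable]: "u \<in> borel_measurable D" by (rule L2_measurable[OF H2_diamond_primitive2(1)[OF u]])
  show ?thesis
  proof (rule L2_bounded_mult[OF f])
    show "AE x in D. cmod (u x / of_real x) \<le> S"
      using S(2) AE_D_bounds by eventually_elim (simp add: norm_divide divide_le_eq)
  qed measurable
qed

section \<open>The equations satisfied by a zero of the operator\<close>

text \<open>The coefficient of the conjugate of \<open>\<phi>2\<close> in \<open>T_form\<close>,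
  that is, the left-hand side of the first equation in strong form.\<close>

definition residual1 where
  "residual1 q \<chi>1 \<omega> u1 u2 x = wderiv2 u1 x + \<omega>\<^sup>2 * of_real (q x) * u1 x
     + \<omega>\<^sup>2 / of_real x * of_real (\<chi>1 x) * u2 x * cnj (u1 x)"
  for q \<chi>1 :: "real \<Rightarrow> real" and \<omega> :: complex and u1 u2 :: "real \<Rightarrow> complex"

text \<open>The coefficient of the conjugate of \<open>\<phi>1\<close>. The second equation is u2''
  + \<open>residual2\<close> = 0, but \<open>u2\<close> is only in \<open>L2\<close>, so both
  derivatives stay on the test function.\<close>

definition residual2 where
  "residual2 q \<chi>2 \<omega> u1 u2 x = 4 * \<omega>\<^sup>2 * of_real (q x) * u2 x + \<omega>\<^sup>2 / of_real x * of_real (\<chi>2 x) * (u1 x)\<^sup>2"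
  for q \<chi>2 :: "real \<Rightarrow> real" and \<omega> :: complex and u1 u2 :: "real \<Rightarrow> complex"

lemma residual1_L2:
  assumes "q \<in> Linf" "\<chi>1 \<in> Linf" "u1 \<in> H2_diamond" "u2 \<in> L2"
  shows "residual1 q \<chi>1 \<omega> u1 u2 \<in> L2"
proof -
  note u = H2_diamond_primitive2[OF assms(3)]
  have "(\<lambda>x. cnj (u1 x / of_real x * cnj (u2 x))) \<in> L2"
    by (intro L2_cnj H2_diamond_divide_mult_L2 assms)
  from L2_cmult[OF Linf_mult_L2[OF assms(2) this], of "\<omega>\<^sup>2"]
  have "(\<lambda>x. \<omega>\<^sup>2 / of_real x * of_real (\<chi>1 x) * u2 x * cnj (u1 x)) \<in> L2"
    by (rule back_subst[of "\<lambda>f. f \<in> L2"]) (auto simp: fun_eq_iff)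
  moreover have "(\<lambda>x. \<omega>\<^sup>2 * of_real (q x) * u1 x) \<in> L2"
    using L2_cmult[OF Linf_mult_L2[OF assms(1) u(1)], of "\<omega>\<^sup>2"] by (simp add: mult.assoc)
  ultimately show ?thesis
    unfolding residual1_def[abs_def] using u(2) by (intro L2_add)
qed

lemma residual2_L2:
  assumes "q \<in> Linf" "\<chi>2 \<in> Linf" "u1 \<in> H2_diamond" "u2 \<in> L2"
  shows "residual2 q \<chi>2 \<omega> u1 u2 \<in> L2"
proof -
  note u = H2_diamond_primitive2[OF assms(3)]
  have "(\<lambda>x. u1 x / of_real x * u1 x) \<in> L2"
    by (intro H2_diamond_divide_mult_L2 assms u)
  from L2_cmult[OF Linf_mult_L2[OF assms(2) this], of "\<omega>\<^sup>2"]
  have "(\<lambda>x. \<omega>\<^sup>2 / of_real x * of_real (\<chi>2 x) * (u1 x)\<^sup>2) \<in> L2"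
    by (rule back_subst[of "\<lambda>f. f \<in> L2"]) (auto simp: fun_eq_iff power2_eq_square)
  moreover have "(\<lambda>x. 4 * \<omega>\<^sup>2 * of_real (q x) * u2 x) \<in> L2"
    using L2_cmult[OF Linf_mult_L2[OF assms(1,4)], of "4 * \<omega>\<^sup>2"] by (simp add: mult.assoc)
  ultimately show ?thesis
    unfolding residual2_def[abs_def] by (intro L2_add)
qed

lemma T_form_residuals:
  assumes "q \<in> Linf" "\<chi>1 \<in> Linf" "\<chi>2 \<in> Linf" "u1 \<in> H2_diamond" "u2 \<in> L2"
    and \<phi>: "\<phi>1 \<in> H2_diamond" "\<phi>2 \<in> L2"
  shows "T_form q \<chi>1 \<chi>2 \<omega> (u1, u2) (\<phi>1, \<phi>2) = L2_inner (residual1 q \<chi>1 \<omega> u1 u2) \<phi>2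
    + (L2_inner u2 (wderiv2 \<phi>1) + L2_inner (residual2 q \<chi>2 \<omega> u1 u2) \<phi>1)"
proof -
  have i: "integrable D (\<lambda>x. u2 x * cnj (wderiv2 \<phi>1 x))"
    "integrable D (\<lambda>x. residual2 q \<chi>2 \<omega> u1 u2 x * cnj (\<phi>1 x))"
    using H2_diamond_primitive2[OF \<phi>(1)] assms by (auto intro!: L2_mult_cnj_integrable residual2_L2)
  have "(LINT x|D. u2 x * (cnj (wderiv2 \<phi>1 x) + 4 * \<omega>\<^sup>2 * of_real (q x) * cnj (\<phi>1 x))
          + \<omega>\<^sup>2 / of_real x * of_real (\<chi>2 x) * (u1 x)\<^sup>2 * cnj (\<phi>1 x))
      = (LINT x|D. u2 x * cnj (wderiv2 \<phi>1 x) + residual2 q \<chi>2 \<omega> u1 u2 x * cnj (\<phi>1 x))"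
    by (rule Bochner_Integration.integral_cong) (auto simp: residual2_def algebra_simps)
  also have "\<dots> = L2_inner u2 (wderiv2 \<phi>1) + L2_inner (residual2 q \<chi>2 \<omega> u1 u2) \<phi>1"
    unfolding L2_inner_def by (rule Bochner_Integration.integral_add[OF i])
  moreover have "(LINT x|D. (wderiv2 u1 x + \<omega>\<^sup>2 * of_real (q x) * u1 x) * cnj (\<phi>2 x)
          + \<omega>\<^sup>2 / of_real x * of_real (\<chi>1 x) * u2 x * cnj (u1 x) * cnj (\<phi>2 x))
      = L2_inner (residual1 q \<chi>1 \<omega> u1 u2) \<phi>2"
    unfolding L2_inner_def
    by (rule Bochner_Integration.integral_cong) (auto simp: residual1_def algebra_simps)
  ultimately show ?thesis by (simp add: T_form_def)
qed

lemma L2_inner_AE_zero: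
  assumes "AE x in D. f x = 0" shows "L2_inner f g = 0" "L2_inner g f = 0"
  unfolding L2_inner_def by (rule integral_eq_zero_AE; use assms in \<open>auto elim: eventually_mono\<close>)+

text \<open>Existence of a representative makes the choice in \<open>T_diamond\<close> satisfy its
  defining property. A representative that vanishes almost everywhere has a vanishing second weak
  derivative too, hence inner product 0 with every \<open>\<phi>\<close>.\<close>

lemma T_diamond_zero_imp:
  assumes "q \<in> Linf" "\<chi>1 \<in> Linf" "\<chi>2 \<in> Linf" and u: "u1 \<in> H2_diamond" "u2 \<in> L2"
    and zero: "X_zero (T_diamond q \<chi>1 \<chi>2 \<omega> (u1, u2))" and \<phi>: "\<phi> \<in> X_diamond"
  shows "T_form q \<chi>1 \<chi>2 \<omega> (u1, u2) \<phi> = 0"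
proof -
  let ?R1 = "residual1 q \<chi>1 \<omega> u1 u2" and ?R2 = "residual2 q \<chi>2 \<omega> u1 u2"
  let ?T = "T_diamond q \<chi>1 \<chi>2 \<omega> (u1, u2)"
  obtain w where w: "w \<in> H2_diamond" and wR: "\<And>\<phi>. \<phi> \<in> H2_diamond \<Longrightarrow>
    H2_inner w \<phi> = (LINT x|D. u2 x * cnj (wderiv2 \<phi> x)) + (LINT x|D. ?R2 x * cnj (\<phi> x))"
    using H2_Riesz[OF u(2) residual2_L2[OF assms(1,3) u]] by blast
  \<comment> \<open>In the second component the inner product is that of \<open>L2\<close>, so the
    residual represents itself; only the first component needs \<open>H2_Riesz\<close>.\<close>
  have "(w, ?R1) \<in> X_diamond \<and> (\<forall>\<phi>\<in>X_diamond. X_inner (w, ?R1) \<phi> = T_form q \<chi>1 \<chi>2 \<omega> (u1, u2) \<phi>)"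
    using w residual1_L2[OF assms(1,2) u]
    by (auto simp: X_diamond_def X_inner_def T_form_residuals[OF assms(1-3) u] wR L2_inner_def)
  then have "?T \<in> X_diamond \<and> (\<forall>\<phi>\<in>X_diamond. X_inner ?T \<phi> = T_form q \<chi>1 \<chi>2 \<omega> (u1, u2) \<phi>)"
    unfolding T_diamond_def by (rule someI)
  then have T: "?T \<in> X_diamond" "X_inner ?T \<phi> = T_form q \<chi>1 \<chi>2 \<omega> (u1, u2) \<phi>" using \<phi> by auto
  have z: "AE x in D. fst ?T x = 0" "AE x in D. snd ?T x = 0" using zero by (auto simp: X_zero_def)
  have "fst ?T \<in> borel_measurable D"
    using T(1) by (intro L2_measurable H2_diamond_primitive2(1)) (simp add: X_diamond_def mem_Times_iff)
  from wderiv2_AE_zero[OF this z(1)] z T(2) show ?thesis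
    by (simp add: X_inner_def H2_inner_def L2_inner_AE_zero)
qed

text \<open>A zero (u1, u2) of the operator, not assumed to be nontrivial: the results below
  conclude that it is trivial.\<close>

locale T_zero =
  fixes q \<chi>1 \<chi>2 :: "real \<Rightarrow> real" and \<omega> :: complex and u1 u2 :: "real \<Rightarrow> complex"
  assumes q: "q \<in> Linf" and \<chi>1: "\<chi>1 \<in> Linf" and \<chi>2: "\<chi>2 \<in> Linf" and \<chi>2_pos: "AE x in D. 0 < \<chi>2 x"
    and u1: "u1 \<in> H2_diamond" and u2: "u2 \<in> L2"
    and zero: "X_zero (T_diamond q \<chi>1 \<chi>2 \<omega> (u1, u2))" and \<omega>: "\<omega> \<noteq> 0"
begin

lemma measurables [measurable]:
  "q \<in> borel_measurable D" "\<chi>1 \<in> borel_measurable D" "\<chi>2 \<in> borel_measurable D"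
  "u1 \<in> borel_measurable D" "u2 \<in> borel_measurable D"
  using q \<chi>1 \<chi>2 u2 H2_diamond_primitive2(1)[OF u1] by auto

lemma u1_L2: "u1 \<in> L2"
  by (rule H2_diamond_primitive2(1)[OF u1])

text \<open>\<open>\<phi>2\<close> ranges over all of \<open>L2\<close>, so it can be taken to be
  the residual itself, with \<open>\<phi>1\<close> = 0.\<close>

lemma first_equation: "AE x in D. residual1 q \<chi>1 \<omega> u1 u2 x = 0"
proof (rule L2_mult_cnj_zero_imp_AE)
  show R: "residual1 q \<chi>1 \<omega> u1 u2 \<in> L2" by (rule residual1_L2[OF q \<chi>1 u1 u2])
  have "primitive2 0 (\<lambda>x. 0) = (\<lambda>x. 0)" by (simp add: primitive2_def)
  then have 0: "(\<lambda>x. 0) \<in> H2_diamond" using primitive2_in_H2_diamond[of "\<lambda>x. 0" 0] by simp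
  have "AE x in D. wderiv2 (\<lambda>x. 0) x = 0" by (rule wderiv2_AE_zero) auto
  then have "T_form q \<chi>1 \<chi>2 \<omega> (u1, u2) (\<lambda>x. 0, residual1 q \<chi>1 \<omega> u1 u2)
      = L2_inner (residual1 q \<chi>1 \<omega> u1 u2) (residual1 q \<chi>1 \<omega> u1 u2)"
    using T_form_residuals[OF q \<chi>1 \<chi>2 u1 u2 0 R] by (simp add: L2_inner_AE_zero)
  moreover have "(\<lambda>x. 0, residual1 q \<chi>1 \<omega> u1 u2) \<in> X_diamond" using 0 R by (simp add: X_diamond_def)
  ultimately show "(LINT x|D. residual1 q \<chi>1 \<omega> u1 u2 x * cnj (residual1 q \<chi>1 \<omega> u1 u2 x)) = 0"
    using T_diamond_zero_imp[OF q \<chi>1 \<chi>2 u1 u2 zero] by (simp add: L2_inner_def)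
qed

text \<open>Parametrising the test function by its slope b and its second derivative h replaces
  \<open>wderiv2\<close> by the given function h.\<close>

lemma second_equation:
  assumes h: "h \<in> L2"
  shows "(LINT x|D. u2 x * cnj (h x)) + (LINT x|D. residual2 q \<chi>2 \<omega> u1 u2 x * cnj (primitive2 b h x)) = 0"
proof -
  have \<phi>: "primitive2 b h \<in> H2_diamond" by (rule primitive2_in_H2_diamond[OF h])
  then have "(primitive2 b h, \<lambda>x. 0) \<in> X_diamond" by (simp add: X_diamond_def)
  from T_diamond_zero_imp[OF q \<chi>1 \<chi>2 u1 u2 zero this]
  have "L2_inner u2 (wderiv2 (primitive2 b h)) + L2_inner (residual2 q \<chi>2 \<omega> u1 u2) (primitive2 b h) = 0"
    using T_form_residuals[OF q \<chi>1 \<chi>2 u1 u2 \<phi>, of "\<lambda>x. 0"] by (simp add: L2_inner_def)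
  moreover have "L2_inner u2 (wderiv2 (primitive2 b h)) = (LINT x|D. u2 x * cnj (h x))"
    unfolding L2_inner_def
  proof (rule integral_cong_AE)
    have 1: "wderiv2 (primitive2 b h) \<in> L2" by (rule H2_diamond_primitive2(2)[OF \<phi>])
    show "(\<lambda>x. u2 x * cnj (wderiv2 (primitive2 b h) x)) \<in> borel_measurable D"
      "(\<lambda>x. u2 x * cnj (h x)) \<in> borel_measurable D"
      using L2_mult_cnj_integrable[OF u2 1] L2_mult_cnj_integrable[OF u2 h] by auto
    show "AE x in D. u2 x * cnj (wderiv2 (primitive2 b h) x) = u2 x * cnj (h x)"
      using wderiv2_primitive2[OF h, of b] by eventually_elim simp
  qed
  ultimately show ?thesis by (simp add: L2_inner_def)
qed

section \<open>Integral estimates for a zero of the operator\<close>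

text \<open>W of the overview. As \<open>\<chi>2\<close> is positive, \<open>weight\<close> and
  \<open>mass\<close> detect the vanishing of \<open>u1\<close> and \<open>u2\<close>.\<close>

definition weight where "weight = (LINT x|D. \<chi>2 x * (cmod (u1 x))\<^sup>2)"
definition mass where "mass = (LINT x|D. cmod (u2 x))"

lemma weight_integrable: "integrable D (\<lambda>x. \<chi>2 x * (cmod (u1 x))\<^sup>2)"
  using Linf_mult_integrable[OF \<chi>2 L2_square_integrable[OF u1_L2]] by simp

lemma weight_nonneg: "0 \<le> weight"
  unfolding weight_def by (rule integral_nonneg_AE) (use \<chi>2_pos in \<open>auto elim: eventually_mono\<close>)

lemma mass_nonneg: "0 \<le> mass"
  unfolding mass_def by simp

lemma mass_zero: "mass = 0 \<Longrightarrow> AE x in D. u2 x = 0"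
  using integral_nonneg_eq_0_iff_AE[of D "\<lambda>x. cmod (u2 x)"] L2_integrable[OF u2] by (simp add: mass_def)

lemma weight_zero: "weight = 0 \<Longrightarrow> AE x in D. u1 x = 0"
proof -
  assume "weight = 0"
  then have "AE x in D. \<chi>2 x * (cmod (u1 x))\<^sup>2 = 0"
    unfolding weight_def using \<chi>2_pos
    by (subst (asm) integral_nonneg_eq_0_iff_AE[OF weight_integrable]) (auto elim: eventually_mono)
  then show ?thesis using \<chi>2_pos by eventually_elim auto
qed

text \<open>Testing the second equation with the twofold primitive of \<open>u2\<close>.\<close>

lemma mass_bound:
  assumes small: "8 * (cmod \<omega>)\<^sup>2 * Linf_norm q \<le> 1"
  shows "mass \<le> 2 * (cmod \<omega>)\<^sup>2 * weight"
proof -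
  let ?\<phi> = "primitive2 0 u2" and ?R = "residual2 q \<chi>2 \<omega> u1 u2"
  define w where "w = (cmod \<omega>)\<^sup>2"
  let ?Q = "Linf_norm q"
  have R: "?R \<in> L2" by (rule residual2_L2[OF q \<chi>2 u1 u2])
  have \<phi>: "cmod (?\<phi> x) \<le> mass * x" if "x \<in> {0..1}" for x
    using primitive2_linear_bound(2)[OF u2 that, of 0] by (simp add: mass_def)
  have u2i: "integrable D (\<lambda>x. cmod (u2 x))" using L2_integrable[OF u2] by simp
  have "(LINT x|D. (cmod (u2 x))\<^sup>2) = cmod (LINT x|D. u2 x * cnj (u2 x))"
  proof -
    have "(LINT x|D. u2 x * cnj (u2 x)) = (LINT x|D. complex_of_real ((cmod (u2 x))\<^sup>2))"
      by (simp only: complex_norm_square)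
    also have "\<dots> = complex_of_real (LINT x|D. (cmod (u2 x))\<^sup>2)"
      by (rule integral_of_real[OF L2_square_integrable[OF u2]])
    finally show ?thesis by simp
  qed
  also have "\<dots> = cmod (LINT x|D. ?R x * cnj (?\<phi> x))"
    using second_equation[OF u2, of 0] by (metis add_eq_0_iff norm_minus_cancel)
  also have "\<dots> \<le> (LINT x|D. cmod (?R x * cnj (?\<phi> x)))" by (rule integral_norm_bound)
  also have "\<dots> \<le> (LINT x|D. 4 * w * ?Q * mass * cmod (u2 x) + w * mass * (\<chi>2 x * (cmod (u1 x))\<^sup>2))"
  proof (rule integral_mono_AE)
    show "integrable D (\<lambda>x. cmod (?R x * cnj (?\<phi> x)))"
      using L2_mult_cnj_integrable[OF R primitive2_L2[OF u2]] by (rule integrable_norm)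
    show "integrable D (\<lambda>x. 4 * w * ?Q * mass * cmod (u2 x) + w * mass * (\<chi>2 x * (cmod (u1 x))\<^sup>2))"
      using u2i weight_integrable by (intro Bochner_Integration.integrable_add integrable_mult_right)
    show "AE x in D. cmod (?R x * cnj (?\<phi> x)) \<le> 4 * w * ?Q * mass * cmod (u2 x) + w * mass * (\<chi>2 x * (cmod (u1 x))\<^sup>2)"
      using Linf_AE_le[OF q] \<chi>2_pos AE_D_bounds
    proof eventually_elim
      case (elim x)
      have p: "cmod (?\<phi> x) \<le> mass * x" using \<phi> elim by simp
      have "mass * x \<le> mass * 1" using elim mass_nonneg by (intro mult_left_mono) auto
      then have p1: "cmod (?\<phi> x) \<le> mass" using p by linarith
      have "cmod (?R x * cnj (?\<phi> x)) = cmod (?R x) * cmod (?\<phi> x)" by (simp add: norm_mult)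
      also have "\<dots> \<le> (4 * w * \<bar>q x\<bar> * cmod (u2 x) + w / x * \<chi>2 x * (cmod (u1 x))\<^sup>2) * cmod (?\<phi> x)"
      proof (rule mult_right_mono)
        show "cmod (?R x) \<le> 4 * w * \<bar>q x\<bar> * cmod (u2 x) + w / x * \<chi>2 x * (cmod (u1 x))\<^sup>2"
          unfolding residual2_def w_def
          by (rule order_trans[OF norm_triangle_ineq]) (use elim in \<open>simp add: norm_mult norm_divide norm_power\<close>)
      qed simp
      also have "\<dots> = 4 * w * \<bar>q x\<bar> * cmod (u2 x) * cmod (?\<phi> x) + w / x * \<chi>2 x * (cmod (u1 x))\<^sup>2 * cmod (?\<phi> x)"
        by (simp add: distrib_right)
      \<comment> \<open>In the first term the crude bound \<open>mass\<close> for the test function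
        suffices; in the second the bound \<open>mass * x\<close> is needed to cancel 1/x.\<close>
      also have "\<dots> \<le> 4 * w * ?Q * cmod (u2 x) * mass + w / x * \<chi>2 x * (cmod (u1 x))\<^sup>2 * (mass * x)"
        using elim p p1 mass_nonneg unfolding w_def
        by (intro add_mono mult_mono mult_left_mono) (auto intro!: mult_nonneg_nonneg divide_nonneg_nonneg Linf_norm_nonneg[OF q])
      also have "\<dots> = 4 * w * ?Q * mass * cmod (u2 x) + w * mass * (\<chi>2 x * (cmod (u1 x))\<^sup>2)"
        using elim by simp
      finally show ?case .
    qed
  qed
  also have "\<dots> = 4 * w * ?Q * mass * mass + w * mass * weight"
    unfolding mass_def weight_def using u2i weight_integrable by simp
  finally have "mass\<^sup>2 \<le> 4 * w * ?Q * mass * mass + w * mass * weight"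
    using L2_norm_square_bound[OF u2] by (simp add: mass_def)
  then have 1: "mass * mass \<le> mass * (4 * w * ?Q * mass + w * weight)"
    by (simp add: power2_eq_square algebra_simps)
  \<comment> \<open>The factor 8 of the hypothesis allows half of \<open>mass\<close> to be absorbed
    into the left-hand side.\<close>
  have 2: "4 * w * ?Q * mass \<le> 1 / 2 * mass"
    using small mass_nonneg by (intro mult_right_mono) (auto simp: w_def)
  show ?thesis
  proof (cases "mass = 0")
    case True
    then show ?thesis using weight_nonneg by simp
  next
    case False
    then have "mass \<le> 4 * w * ?Q * mass + w * weight" using 1 mass_nonneg by simp
    then show ?thesis using 2 unfolding w_def by linarith
  qed
qed

text \<open>The test function x has second derivative 0 and cancels 1/x in \<open>residual2\<close>.
  What remains carries the common factor \<open>\<omega>\<^sup>2\<close>, which divides out, so the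
  bound is free of \<open>\<omega>\<close>.\<close>

lemma moment_bound:
  "cmod (LINT x|D. of_real (\<chi>2 x) * (u1 x)\<^sup>2) \<le> 4 * Linf_norm q * mass"
proof -
  let ?R = "residual2 q \<chi>2 \<omega> u1 u2"
  have u2i: "integrable D (\<lambda>x. cmod (u2 x))" using L2_integrable[OF u2] by simp
  have x2: "integrable D (\<lambda>x. of_real x * u2 x)"
    by (rule L2_mult_integrable[OF continuous_on_L2 u2]) (intro continuous_intros)
  have qi: "integrable D (\<lambda>x. of_real (q x) * (of_real x * u2 x))"
    by (rule Linf_mult_integrable[OF q x2])
  have ui: "integrable D (\<lambda>x. of_real (\<chi>2 x) * (u1 x)\<^sup>2)"
    using Linf_mult_integrable[OF \<chi>2 L2_mult_integrable[OF u1_L2 u1_L2]] by (simp add: power2_eq_square)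
  have "0 = (LINT x|D. ?R x * cnj (primitive2 1 (\<lambda>x. 0) x))"
    using second_equation[of "\<lambda>x. 0" 1] by simp
  also have "\<dots> = (LINT x|D. \<omega>\<^sup>2 * (4 * (of_real (q x) * (of_real x * u2 x)) + of_real (\<chi>2 x) * (u1 x)\<^sup>2))"
    by (rule Bochner_Integration.integral_cong)
      (auto simp: primitive2_eq residual2_def field_simps)
  also have "\<dots> = \<omega>\<^sup>2 * (4 * (LINT x|D. of_real (q x) * (of_real x * u2 x)) + (LINT x|D. of_real (\<chi>2 x) * (u1 x)\<^sup>2))"
    using qi ui by simp
  finally have "(LINT x|D. of_real (\<chi>2 x) * (u1 x)\<^sup>2) = - (4 * (LINT x|D. of_real (q x) * (of_real x * u2 x)))"
    using \<omega> by (simp add: eq_neg_iff_add_eq_0 add.commute)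
  then have "cmod (LINT x|D. of_real (\<chi>2 x) * (u1 x)\<^sup>2) = 4 * cmod (LINT x|D. of_real (q x) * (of_real x * u2 x))"
    by (simp add: norm_mult)
  moreover have "cmod (LINT x|D. of_real (q x) * (of_real x * u2 x)) \<le> Linf_norm q * mass"
  proof -
    have "cmod (LINT x|D. of_real (q x) * (of_real x * u2 x)) \<le> (LINT x|D. cmod (of_real (q x) * (of_real x * u2 x)))"
      by (rule integral_norm_bound)
    also have "\<dots> \<le> (LINT x|D. Linf_norm q * cmod (u2 x))"
    proof (rule integral_mono_AE)
      show "AE x in D. cmod (of_real (q x) * (of_real x * u2 x)) \<le> Linf_norm q * cmod (u2 x)"
        using Linf_AE_le[OF q] AE_D_bounds
      proof eventually_elim
        case (elim x)
        then have "\<bar>q x\<bar> * (\<bar>x\<bar> * cmod (u2 x)) \<le> Linf_norm q * (1 * cmod (u2 x))"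
          by (intro mult_mono) auto
        then show ?case by (simp add: norm_mult)
      qed
    qed (use qi u2i in auto)
    finally show ?thesis by (simp add: mass_def)
  qed
  ultimately show ?thesis by simp
qed

end


section \<open>Uniqueness for a homogeneous Volterra equation\<close>

lemma coprimitive_cong_AE:
  assumes [measurable]: "f \<in> borel_measurable D" "g \<in> borel_measurable D" and "AE x in D. f x = g x"
  shows "coprimitive f = coprimitive g"
proof -
  have "(LINT s|D. f s) = (LINT s|D. g s)" by (rule integral_cong_AE) (use assms in auto)
  then show ?thesis using primitive_cong_AE[OF assms] by (simp add: coprimitive_def fun_eq_iff)
qed

text \<open>The tail integral of the exponential weight is the weight minus 1, divided by
  \<open>\<alpha>\<close>. Each tail integration thus gains a factor 1/\<open>\<alpha>\<close> in
  the weighted supremum.\<close>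

lemma coprimitive_exp_bound:
  assumes f: "f \<in> L2" and \<alpha>: "0 < \<alpha>" and m: "0 \<le> m" and x: "x \<in> {0..1}"
    and b: "\<And>s. s \<in> {0..1} \<Longrightarrow> cmod (f s) \<le> m * exp (\<alpha> * (1 - s))"
  shows "cmod (coprimitive f x) \<le> m / \<alpha> * exp (\<alpha> * (1 - x))"
proof -
  let ?g = "\<lambda>s. m * exp (\<alpha> * (1 - s))" and ?F = "\<lambda>s. - (m / \<alpha>) * exp (\<alpha> * (1 - s))"
  have cont: "continuous_on {0..1} (\<lambda>s. complex_of_real (?g s))"
    by (intro continuous_intros)
  have P: "primitive (\<lambda>s. complex_of_real (?g s)) y = of_real (?F y) - of_real (?F 0)" if "y \<in> {0..1}" for y
  proof (rule primitive_FTC[OF _ cont that])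
    fix t :: real
    have "(?F has_real_derivative ?g t) (at t within {0..1})"
      using \<alpha> by (auto intro!: derivative_eq_intros)
    then show "((\<lambda>s. complex_of_real (?F s)) has_vector_derivative of_real (?g t)) (at t within {0..1})"
      by (intro has_vector_derivative_of_real) (simp add: has_real_derivative_iff_has_vector_derivative)
  qed
  have i: "integrable D ?g"
    using L2_integrable[OF continuous_on_L2[OF cont]] by (simp only: complex_of_real_integrable_eq)
  have "complex_of_real (LINT s|D. ?g s) = primitive (\<lambda>s. of_real (?g s)) 1"
    unfolding integral_eq_primitive[symmetric] by (rule integral_of_real[symmetric, OF i])
  also have "\<dots> = of_real (?F 1 - ?F 0)" using P[of 1] by simp
  finally have 1: "(LINT s|D. ?g s) = ?F 1 - ?F 0" by (simp only: of_real_eq_iff)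
  have ix: "integrable D (\<lambda>s. if s < x then ?g s else 0)"
  proof (rule Bochner_Integration.integrable_bound[OF i])
    show "(\<lambda>s. if s < x then ?g s else 0) \<in> borel_measurable D" by measurable
  qed auto
  have "complex_of_real (LINT s|D. (if s < x then ?g s else 0)) = (LINT s|D. complex_of_real (if s < x then ?g s else 0))"
    by (rule integral_of_real[symmetric, OF ix])
  also have "\<dots> = primitive (\<lambda>s. of_real (?g s)) x"
    unfolding primitive_def by (rule Bochner_Integration.integral_cong) auto
  also have "\<dots> = of_real (?F x - ?F 0)" using P[OF x] by simp
  finally have 2: "(LINT s|D. (if s < x then ?g s else 0)) = ?F x - ?F 0" by (simp only: of_real_eq_iff)
  have "cmod (coprimitive f x) \<le> (LINT s|D. ?g s) - (LINT s|D. (if s < x then ?g s else 0))"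
    by (rule coprimitive_norm_le[OF f i]) (use b in auto)
  also have "\<dots> = m / \<alpha> * exp (\<alpha> * (1 - x)) - m / \<alpha>" unfolding 1 2 by simp
  also have "\<dots> \<le> m / \<alpha> * exp (\<alpha> * (1 - x))" using m \<alpha> by simp
  finally show ?thesis .
qed

text \<open>Weighting the supremum by \<open>exp (- \<alpha> (1 - x))\<close> with large \<open>\<alpha>\<close> makes the Volterra operator a
  contraction.\<close>

lemma coprimitive_eigenfunction_zero:
  assumes f: "f \<in> L2" and eig: "AE x in D. f x = c * coprimitive (coprimitive f) x"
  shows "AE x in D. f x = 0"
proof -
  \<comment> \<open>A continuous representative of \<open>f\<close>, which satisfies the equation at
    every point and so has a weighted supremum that is attained.\<close>
  define v where "v x = c * coprimitive (coprimitive f) x" for x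
  have cont: "continuous_on {0..1} v"
    unfolding v_def by (intro continuous_intros coprimitive_continuous_on coprimitive_L2 f)
  have vL: "v \<in> L2" by (rule continuous_on_L2[OF cont])
  have "coprimitive f = coprimitive v"
    by (rule coprimitive_cong_AE) (use f vL eig in \<open>auto simp: v_def[abs_def]\<close>)
  then have v: "v x = c * coprimitive (coprimitive v) x" for x by (simp add: v_def)
  \<comment> \<open>Two tail integrations give the factor \<open>cmod c\<close> over
    \<open>\<alpha>\<close> squared, which this choice makes less than 1.\<close>
  define \<alpha> where "\<alpha> = cmod c + 1"
  have \<alpha>: "0 < \<alpha>" by (simp add: \<alpha>_def add_nonneg_pos)
  have "continuous_on {0..1} (\<lambda>x. cmod (v x) * exp (- (\<alpha> * (1 - x))))"
    using cont by (intro continuous_intros)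
  then obtain x0 where x0: "x0 \<in> {0..1}"
    "\<And>x. x \<in> {0..1} \<Longrightarrow> cmod (v x) * exp (- (\<alpha> * (1 - x))) \<le> cmod (v x0) * exp (- (\<alpha> * (1 - x0)))"
    using continuous_attains_sup[of "{0..1}" "\<lambda>x. cmod (v x) * exp (- (\<alpha> * (1 - x)))"] by auto
  define m where "m = cmod (v x0) * exp (- (\<alpha> * (1 - x0)))"
  have m: "0 \<le> m" by (simp add: m_def)
  have bound: "cmod (v x) \<le> m * exp (\<alpha> * (1 - x))" if "x \<in> {0..1}" for x
    using mult_right_mono[OF x0(2)[OF that], of "exp (\<alpha> * (1 - x))"]
    by (simp add: m_def mult.assoc flip: exp_add)
  have "cmod (coprimitive v x) \<le> m / \<alpha> * exp (\<alpha> * (1 - x))" if "x \<in> {0..1}" for x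
    by (rule coprimitive_exp_bound[OF vL \<alpha> m that bound])
  then have "cmod (coprimitive (coprimitive v) x0) \<le> m / \<alpha> / \<alpha> * exp (\<alpha> * (1 - x0))"
    using m \<alpha> by (intro coprimitive_exp_bound[OF coprimitive_L2[OF vL] \<alpha> _ x0(1)]) auto
  then have "cmod (v x0) \<le> cmod c * (m / \<alpha> / \<alpha> * exp (\<alpha> * (1 - x0)))"
    unfolding v[of x0] norm_mult by (rule mult_left_mono) simp
  from mult_right_mono[OF this, of "exp (- (\<alpha> * (1 - x0)))"]
  have "m \<le> cmod c * (m / \<alpha> / \<alpha>)"
    by (simp add: m_def[symmetric] mult.assoc flip: exp_add)
  then have "m * (\<alpha> * \<alpha>) \<le> m * cmod c" using \<alpha> by (simp add: field_simps)
  moreover have "cmod c < \<alpha> * \<alpha>"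
    by (simp add: \<alpha>_def algebra_simps add_pos_nonneg)
  ultimately have "m = 0" using m by (metis less_eq_real_def mult_le_cancel_left_pos not_le)
  then have vz: "v x = 0" if "x \<in> {0..1}" for x using bound[OF that] by simp
  show ?thesis
    using eig AE_D_bounds
  proof eventually_elim
    case (elim x)
    then show ?case using vz[of x] by (simp add: v_def)
  qed
qed

lemma L2_inner_self: "f \<in> L2 \<Longrightarrow> L2_inner f f = complex_of_real (LINT x|D. (cmod (f x))\<^sup>2)"
  unfolding L2_inner_def complex_norm_square[symmetric]
  by (rule integral_of_real[OF L2_square_integrable])

text \<open>Lets a positive norm stand for nontriviality, as the second claim requires.\<close>

lemma X_norm_zero:
  assumes "u \<in> X_diamond" "X_zero u" shows "X_norm u = 0"
proof -
  have "AE x in D. wderiv2 (fst u) x = 0"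
    by (rule wderiv2_AE_zero)
      (use assms in \<open>auto simp: X_diamond_def X_zero_def intro!: L2_measurable H2_diamond_primitive2(1)\<close>)
  then show ?thesis
    using assms(2) by (simp add: X_norm_def X_inner_def H2_inner_def X_zero_def L2_inner_AE_zero)
qed

text \<open>This moment is the numerator of the constant in the first claim. Its upper bound shows
  that the norm of \<open>\<chi>2\<close> is positive.\<close>

lemma second_moment:
  assumes \<chi>2: "\<chi>2 \<in> Linf" and \<chi>2_pos: "AE x in D. 0 < \<chi>2 x"
  shows "integrable D (\<lambda>x. \<chi>2 x * x\<^sup>2)" "0 < (LINT x|D. \<chi>2 x * x\<^sup>2)"
    "(LINT x|D. \<chi>2 x * x\<^sup>2) \<le> Linf_norm \<chi>2"
proof -
  have "AE x in D. norm (x\<^sup>2) \<le> (1::real)" by (rule AE_I2) (auto simp: power_le_one)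
  then have i2: "integrable D (\<lambda>x::real. x\<^sup>2)" by (intro integrable_D_bounded) auto
  show i: "integrable D (\<lambda>x. \<chi>2 x * x\<^sup>2)"
    using Linf_mult_integrable[OF \<chi>2 i2] by simp
  have "0 \<le> (LINT x|D. \<chi>2 x * x\<^sup>2)"
    by (rule integral_nonneg_AE) (use \<chi>2_pos in \<open>auto elim: eventually_mono\<close>)
  moreover have "(LINT x|D. \<chi>2 x * x\<^sup>2) \<noteq> 0"
  proof
    assume "(LINT x|D. \<chi>2 x * x\<^sup>2) = 0"
    then have "AE x in D. \<chi>2 x * x\<^sup>2 = 0"
      using \<chi>2_pos by (subst (asm) integral_nonneg_eq_0_iff_AE[OF i]) (auto elim: eventually_mono)
    \<comment> \<open>An assertion false almost everywhere on D, phrased for continuous functions so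
      that \<open>continuous_AE_eq\<close> refutes it.\<close>
    then have "AE x in D. (1::complex) = 0"
      using \<chi>2_pos AE_D_bounds by eventually_elim auto
    from continuous_AE_eq[OF _ _ this, of 0] show False by simp
  qed
  ultimately show "0 < (LINT x|D. \<chi>2 x * x\<^sup>2)" by simp
  have "(LINT x|D. \<chi>2 x * x\<^sup>2) \<le> (LINT x|D. Linf_norm \<chi>2)"
  proof (rule integral_mono_AE[OF i])
    show "AE x in D. \<chi>2 x * x\<^sup>2 \<le> Linf_norm \<chi>2"
      using Linf_AE_le[OF \<chi>2] \<chi>2_pos AE_D_bounds
    proof eventually_elim
      case (elim x)
      then have "\<chi>2 x * x\<^sup>2 \<le> Linf_norm \<chi>2 * 1"
        by (intro mult_mono) (auto simp: power_le_one Linf_norm_nonneg[OF \<chi>2])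
      then show ?case by simp
    qed
  qed simp
  then show "(LINT x|D. \<chi>2 x * x\<^sup>2) \<le> Linf_norm \<chi>2" by simp
qed

section \<open>Zeros with real first component\<close>

context T_zero
begin

lemma X_zero_if_weight_zero:
  assumes "weight = 0" "8 * (cmod \<omega>)\<^sup>2 * Linf_norm q \<le> 1" shows "X_zero (u1, u2)"
  unfolding X_zero_def using mass_bound[OF assms(2)] mass_nonneg assms(1) mass_zero weight_zero by simp

text \<open>The norm of (u1, u2) enters the estimates only through this inequality.\<close>

lemma mass_le_X_norm: "mass \<le> X_norm (u1, u2)"
proof -
  have "mass\<^sup>2 \<le> (LINT x|D. (cmod (u2 x))\<^sup>2)"
    unfolding mass_def by (rule L2_norm_square_bound[OF u2])
  also have "\<dots> \<le> Re (X_inner (u1, u2) (u1, u2))"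
    by (simp add: X_inner_def H2_inner_def L2_inner_self u1_L2 u2 H2_diamond_primitive2(2)[OF u1])
  finally show ?thesis
    unfolding X_norm_def using mass_nonneg by (intro real_le_rsqrt)
qed

lemma weight_eq_moment:
  assumes "AE x in D. u1 x \<in> \<real>"
  shows "(LINT x|D. of_real (\<chi>2 x) * (u1 x)\<^sup>2) = complex_of_real weight"
proof -
  have "(LINT x|D. of_real (\<chi>2 x) * (u1 x)\<^sup>2) = (LINT x|D. complex_of_real (\<chi>2 x * (cmod (u1 x))\<^sup>2))"
  proof (rule integral_cong_AE)
    show "AE x in D. of_real (\<chi>2 x) * (u1 x)\<^sup>2 = complex_of_real (\<chi>2 x * (cmod (u1 x))\<^sup>2)"
      using assms by eventually_elim (auto elim!: Reals_cases simp: power2_eq_square simp flip: of_real_mult)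
  qed measurable
  then show ?thesis unfolding weight_def by (simp only: integral_of_real[OF weight_integrable])
qed

text \<open>For real \<open>u1\<close> the moment equals \<open>weight\<close>, so both bounds chain
  to \<open>weight\<close> at most 8 |\<omega>|^2 Q times itself. The factor depends on
  \<open>q\<close> alone because \<open>\<chi>2\<close> is hidden in \<open>weight\<close>.\<close>

lemma X_zero_real_small:
  assumes real: "AE x in D. u1 x \<in> \<real>" and small: "8 * (cmod \<omega>)\<^sup>2 * Linf_norm q < 1"
  shows "X_zero (u1, u2)"
proof -
  have "weight \<le> 4 * Linf_norm q * mass"
    using moment_bound weight_nonneg by (simp add: weight_eq_moment[OF real])
  also have "\<dots> \<le> 4 * Linf_norm q * (2 * (cmod \<omega>)\<^sup>2 * weight)"
    using small by (intro mult_left_mono mass_bound) (auto simp: Linf_norm_nonneg[OF q])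
  finally have "weight * (1 - 8 * (cmod \<omega>)\<^sup>2 * Linf_norm q) \<le> 0" by (simp add: algebra_simps)
  then have "weight \<le> 0" using small by (simp add: mult_le_0_iff)
  then show ?thesis using weight_nonneg small by (intro X_zero_if_weight_zero) auto
qed

text \<open>Here \<open>sin (2 t x)\<close> is a positive solution of the adjoint homogeneous equation.\<close>

lemma X_zero_real_one:
  assumes real: "AE x in D. u1 x \<in> \<real>" and one: "AE x in D. q x = 1"
    and t: "\<omega> = complex_of_real t" "0 < t" "t \<le> pi / 2"
  shows "X_zero (u1, u2)"
proof -
  let ?R = "residual2 q \<chi>2 \<omega> u1 u2"
  have R: "?R \<in> L2" by (rule residual2_L2[OF q \<chi>2 u1 u2])
  \<comment> \<open>The second derivative of sin(2 t x); the slope at 0 is the \<open>b\<close> of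
    the next line.\<close>
  define h where "h x = complex_of_real (- 4 * t\<^sup>2 * sin (2 * t * x))" for x
  define b where "b = complex_of_real (2 * t)"
  have ch: "continuous_on {0..1} h" unfolding h_def by (intro continuous_intros)
  have hL: "h \<in> L2" by (rule continuous_on_L2[OF ch])
  have 1: "primitive h s = of_real (2 * t * cos (2 * t * s)) - of_real (2 * t * cos (2 * t * 0))" if "s \<in> {0..1}" for s
  proof (rule primitive_FTC[OF _ ch that])
    fix s :: real
    have "((\<lambda>s. 2 * t * cos (2 * t * s)) has_real_derivative (- 4 * t\<^sup>2 * sin (2 * t * s))) (at s within {0..1})"
      by (auto intro!: derivative_eq_intros simp: power2_eq_square)
    then show "((\<lambda>s. complex_of_real (2 * t * cos (2 * t * s))) has_vector_derivative h s) (at s within {0..1})"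
      unfolding h_def by (intro has_vector_derivative_of_real) (simp only: has_real_derivative_iff_has_vector_derivative)
  qed
  have cc: "continuous_on {0..1} (\<lambda>s. complex_of_real (2 * t * cos (2 * t * s)))" by (intro continuous_intros)
  have "primitive2 b h = primitive (\<lambda>s. of_real (2 * t * cos (2 * t * s)))"
    unfolding primitive2_def
    by (rule primitive_cong_AE)
      (auto simp: 1 b_def intro!: L2_measurable primitive2_inner hL continuous_on_L2[OF cc])
  moreover have "primitive (\<lambda>s. of_real (2 * t * cos (2 * t * s))) x = of_real (sin (2 * t * x)) - of_real (sin (2 * t * 0))"
    if "x \<in> {0..1}" for x
  proof (rule primitive_FTC[OF _ cc that])
    fix s :: real
    have "((\<lambda>s. sin (2 * t * s)) has_real_derivative (2 * t * cos (2 * t * s))) (at s within {0..1})"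
      by (auto intro!: derivative_eq_intros)
    then show "((\<lambda>s. complex_of_real (sin (2 * t * s))) has_vector_derivative of_real (2 * t * cos (2 * t * s))) (at s within {0..1})"
      by (intro has_vector_derivative_of_real) (simp only: has_real_derivative_iff_has_vector_derivative)
  qed
  ultimately have sin: "primitive2 b h x = of_real (sin (2 * t * x))" if "x \<in> {0..1}" for x
    using that by simp
  \<comment> \<open>The integrand left over when the two \<open>u2\<close> terms of the second
    equation cancel; its sign is that of the sine.\<close>
  define k where "k x = t\<^sup>2 / x * \<chi>2 x * (cmod (u1 x))\<^sup>2 * sin (2 * t * x)" for x
  have [measurable]: "k \<in> borel_measurable D"
  proof -
    have [measurable]: "(\<lambda>x. sin (2 * t * x)) \<in> borel_measurable D" by measurable
    show ?thesis unfolding k_def by measurable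
  qed
  have ints: "integrable D (\<lambda>x. u2 x * cnj (h x))" "integrable D (\<lambda>x. ?R x * cnj (primitive2 b h x))"
    by (intro L2_mult_cnj_integrable u2 hL R primitive2_L2)+
  have ae: "AE x in D. u2 x * cnj (h x) + ?R x * cnj (primitive2 b h x) = complex_of_real (k x)"
    using real one AE_D_bounds
  proof eventually_elim
    case (elim x)
    then obtain r where r: "u1 x = of_real r" by (auto elim: Reals_cases)
    show ?case using elim by (simp add: sin residual2_def k_def h_def t(1) r algebra_simps power2_eq_square)
  qed
  have ki: "integrable D (\<lambda>x. complex_of_real (k x))"
    by (rule integrable_cong_AE_imp[OF Bochner_Integration.integrable_add[OF ints]]) (use ae in auto)
  have "(LINT x|D. complex_of_real (k x)) = (LINT x|D. u2 x * cnj (h x) + ?R x * cnj (primitive2 b h x))"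
    by (rule integral_cong_AE) (use ae ints in \<open>auto elim: eventually_mono\<close>)
  also have "\<dots> = 0" using second_equation[OF hL, of b] ints by simp
  finally have k0: "(LINT x|D. k x) = 0" by simp
  \<comment> \<open>Origin of the threshold \<pi>/2: it keeps 2 t x below \<pi> on (0,1).\<close>
  have sin_pos: "0 < sin (2 * t * x)" if "0 < x" "x < 1" for x
  proof (rule sin_gt_zero)
    have "2 * t * x < 2 * t * 1" using that t by (intro mult_strict_left_mono) auto
    then show "2 * t * x < pi" using t by linarith
  qed (use that t in simp)
  have ki': "integrable D k" using ki by (simp only: complex_of_real_integrable_eq)
  have "AE x in D. 0 \<le> k x"
    using \<chi>2_pos AE_D_bounds
  proof eventually_elim
    case (elim x)
    then show ?case
      unfolding k_def using sin_pos[of x] by (intro mult_nonneg_nonneg divide_nonneg_nonneg) auto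
  qed
  then have "AE x in D. k x = 0" using integral_nonneg_eq_0_iff_AE[OF ki'] k0 by blast
  then have u1z: "AE x in D. u1 x = 0"
    using \<chi>2_pos AE_D_bounds
  proof eventually_elim
    case (elim x)
    then show ?case using sin_pos[of x] t by (auto simp: k_def)
  qed
  define c where "c = complex_of_real (4 * t\<^sup>2)"
  have RA: "AE x in D. ?R x = c * u2 x"
    using u1z one by eventually_elim (simp add: residual2_def c_def t(1))
  have coR: "coprimitive ?R = (\<lambda>x. c * coprimitive u2 x)"
    using coprimitive_cong_AE[OF L2_measurable[OF R] L2_measurable[OF L2_cmult[OF u2]] RA]
    by (simp add: coprimitive_cmult fun_eq_iff)
  let ?C = "coprimitive (coprimitive ?R)"
  have CL: "?C \<in> L2" by (intro coprimitive_L2 R)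
  \<comment> \<open>With slope 0 the second equation, transposed, says that \<open>u2\<close> plus
    the double tail integral of the residual is orthogonal to all of \<open>L2\<close>.\<close>
  have orth: "(LINT x|D. (u2 x + ?C x) * cnj (g x)) = 0" if g: "g \<in> L2" for g
  proof -
    have "(LINT x|D. ?R x * cnj (primitive2 0 g x)) = (LINT x|D. ?R x * primitive2 0 (\<lambda>x. cnj (g x)) x)"
      using primitive2_cnj[OF g, of 0] by simp
    also have "\<dots> = (LINT x|D. ?C x * cnj (g x))"
      using primitive2_by_parts[OF R L2_cnj[OF g], of 0] by simp
    finally show ?thesis
      using second_equation[OF g, of 0] L2_mult_cnj_integrable[OF u2 g] L2_mult_cnj_integrable[OF CL g]
      by (simp add: distrib_right)
  qed
  have "AE x in D. u2 x + ?C x = 0"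
    by (rule L2_mult_cnj_zero_imp_AE[OF L2_add[OF u2 CL] orth[OF L2_add[OF u2 CL]]])
  then have "AE x in D. u2 x = - c * coprimitive (coprimitive u2) x"
    by eventually_elim (simp add: coR coprimitive_cmult eq_neg_iff_add_eq_0)
  then have "AE x in D. u2 x = 0" by (rule coprimitive_eigenfunction_zero[OF u2])
  then show ?thesis using u1z by (simp add: X_zero_def)
qed


section \<open>Zeros with complex first component\<close>

text \<open>The first equation solved for the second derivative. The linear bound for
  \<open>u1\<close> cancels 1/x in the \<open>\<chi>1\<close> term, which leaves the L^1 norm of
  \<open>u2\<close>.\<close>

lemma second_derivative_bound:
  assumes S: "0 \<le> S" and u: "AE x in D. cmod (u1 x) \<le> S * x"
  shows "(LINT x|D. cmod (wderiv2 u1 x)) \<le> (cmod \<omega>)\<^sup>2 * (Linf_norm q + Linf_norm \<chi>1 * mass) * S"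
proof -
  define w where "w = (cmod \<omega>)\<^sup>2"
  have u2i: "integrable D (\<lambda>x. cmod (u2 x))" using L2_integrable[OF u2] by simp
  have "(LINT x|D. cmod (wderiv2 u1 x)) \<le> (LINT x|D. w * Linf_norm q * S + w * Linf_norm \<chi>1 * S * cmod (u2 x))"
  proof (rule integral_mono_AE)
    show "integrable D (\<lambda>x. cmod (wderiv2 u1 x))"
      using L2_integrable[OF H2_diamond_primitive2(2)[OF u1]] by (rule integrable_norm)
    show "integrable D (\<lambda>x. w * Linf_norm q * S + w * Linf_norm \<chi>1 * S * cmod (u2 x))"
      using u2i by (intro Bochner_Integration.integrable_add integrable_const_D integrable_mult_right)
    show "AE x in D. cmod (wderiv2 u1 x) \<le> w * Linf_norm q * S + w * Linf_norm \<chi>1 * S * cmod (u2 x)"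
      using first_equation u Linf_AE_le[OF q] Linf_AE_le[OF \<chi>1] AE_D_bounds
    proof eventually_elim
      case (elim x)
      let ?a = "\<omega>\<^sup>2 * of_real (q x) * u1 x" and ?b = "\<omega>\<^sup>2 / of_real x * of_real (\<chi>1 x) * u2 x * cnj (u1 x)"
      have "wderiv2 u1 x = - (?a + ?b)"
        using elim(1) unfolding residual1_def by (simp only: add.assoc eq_neg_iff_add_eq_0)
      then have "cmod (wderiv2 u1 x) = cmod (?a + ?b)" by (simp only: norm_minus_cancel)
      also have "\<dots> \<le> cmod ?a + cmod ?b" by (rule norm_triangle_ineq)
      also have "cmod ?a = w * (\<bar>q x\<bar> * cmod (u1 x))" by (simp add: norm_mult norm_power w_def)
      also have "\<dots> \<le> w * (Linf_norm q * S)"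
      proof (intro mult_left_mono mult_mono)
        have "S * x \<le> S * 1" using S elim by (intro mult_left_mono) auto
        then show "cmod (u1 x) \<le> S" using elim by linarith
      qed (use elim Linf_norm_nonneg[OF q] in \<open>auto simp: w_def\<close>)
      also have "cmod ?b = w * (\<bar>\<chi>1 x\<bar> * ((cmod (u1 x) / x) * cmod (u2 x)))"
        using elim by (simp add: norm_mult norm_divide norm_power w_def)
      also have "\<dots> \<le> w * (Linf_norm \<chi>1 * (S * cmod (u2 x)))"
      proof (intro mult_left_mono mult_mono mult_right_mono)
        show "cmod (u1 x) / x \<le> S" using elim by (simp add: divide_le_eq)
      qed (use elim S Linf_norm_nonneg[OF \<chi>1] in \<open>auto simp: w_def\<close>)
      finally show ?case by (simp add: mult.assoc)
    qed
  qed
  also have "\<dots> = w * (Linf_norm q + Linf_norm \<chi>1 * mass) * S"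
    using u2i by (simp add: mass_def algebra_simps)
  finally show ?thesis by (simp add: w_def)
qed

lemma weight_le:
  assumes S: "0 \<le> S" and u: "AE x in D. cmod (u1 x) \<le> S * x"
  shows "weight \<le> Linf_norm \<chi>2 * S\<^sup>2"
proof -
  have "weight \<le> (LINT x|D. Linf_norm \<chi>2 * S\<^sup>2)"
    unfolding weight_def
  proof (rule integral_mono_AE[OF weight_integrable])
    show "AE x in D. \<chi>2 x * (cmod (u1 x))\<^sup>2 \<le> Linf_norm \<chi>2 * S\<^sup>2"
      using u Linf_AE_le[OF \<chi>2] AE_D_bounds
    proof eventually_elim
      case (elim x)
      have "S * x \<le> S * 1" using S elim by (intro mult_left_mono) auto
      then have "cmod (u1 x) \<le> S" using elim by linarith
      then show ?case
        using elim Linf_norm_nonneg[OF \<chi>2] by (intro mult_mono power_mono) auto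
    qed
  qed simp
  then show ?thesis by simp
qed

text \<open>By the first equation \<open>u1\<close> is close to \<open>a x\<close>, so the second moment \<open>\<integral> \<chi>2 u1\<^sup>2\<close> is close to
  \<open>a\<^sup>2 \<integral> \<chi>2 x\<^sup>2\<close>, whereas the second equation forces it to be of order \<open>\<omega>\<^sup>2\<close>.\<close>

lemma X_zero_complex_small:
  assumes R: "X_norm (u1, u2) \<le> R" and M: "M = Linf_norm \<chi>1 + Linf_norm \<chi>2"
    and small: "(cmod \<omega>)\<^sup>2 * (M * (1 + M * R)) \<le> (LINT x|D. \<chi>2 x * x\<^sup>2) / (50 * (Linf_norm q + 1))"
  shows "X_zero (u1, u2)"
proof -
  define w where "w = (cmod \<omega>)\<^sup>2"
  define \<kappa> where "\<kappa> = (LINT x|D. \<chi>2 x * x\<^sup>2)"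
  define Q where "Q = Linf_norm q"
  define m where "m = Linf_norm \<chi>2"
  have Q: "0 \<le> Q" and m0: "0 \<le> m" and M1: "0 \<le> Linf_norm \<chi>1"
    unfolding Q_def m_def by (intro Linf_norm_nonneg q \<chi>1 \<chi>2)+
  have \<kappa>: "0 < \<kappa>" "\<kappa> \<le> m" unfolding \<kappa>_def m_def using second_moment[OF \<chi>2 \<chi>2_pos] by simp_all
  have m: "0 < m" "m \<le> M" "0 < M" using \<kappa> M M1 by (auto simp: m_def)
  have massR: "mass \<le> R" using mass_le_X_norm R by linarith
  have R0: "0 \<le> R" using massR mass_nonneg by linarith
  have w0: "0 \<le> w" by (simp add: w_def)
  \<comment> \<open>Bound for the L^1 norm of u1'' relative to S, the constant of the linear bound
    for \<open>u1\<close>.\<close>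
  define \<epsilon> where "\<epsilon> = w * (Q + M * R)"
  have \<epsilon>0: "0 \<le> \<epsilon>" unfolding \<epsilon>_def using w0 Q m R0 by simp
  \<comment> \<open>The smallness hypothesis rearranged: bounding Q + M R by (Q + 1)(1 + M R)
    separates Q from M R.\<close>
  have \<epsilon>m: "\<epsilon> * m \<le> \<kappa> / 50"
  proof -
    have "\<epsilon> * m \<le> \<epsilon> * M" using \<epsilon>0 m by (intro mult_left_mono) auto
    also have "\<dots> = w * M * (Q + M * R)" by (simp add: \<epsilon>_def algebra_simps)
    also have "\<dots> \<le> w * M * ((Q + 1) * (1 + M * R))"
    proof (rule mult_left_mono)
      have "0 \<le> M * R" "0 \<le> Q * (M * R)" using m R0 Q by auto
      then show "Q + M * R \<le> (Q + 1) * (1 + M * R)" by (simp add: algebra_simps)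
    qed (use w0 m in simp)
    also have "\<dots> = (Q + 1) * (w * (M * (1 + M * R)))" by (simp add: algebra_simps)
    also have "\<dots> \<le> (Q + 1) * (\<kappa> / (50 * (Q + 1)))"
      using small Q by (intro mult_left_mono) (auto simp: w_def \<kappa>_def Q_def)
    also have "\<dots> = \<kappa> / 50" using Q by (simp add: field_simps)
    finally show ?thesis .
  qed
  have \<epsilon>: "\<epsilon> \<le> 1 / 50"
  proof -
    have "\<epsilon> * m \<le> 1 / 50 * m" using \<epsilon>m \<kappa> by linarith
    then show ?thesis using m by (simp only: mult_le_cancel_right_pos)
  qed
  have wQ\<epsilon>: "w * Q \<le> \<epsilon>" unfolding \<epsilon>_def using w0 m R0 by (intro mult_left_mono) auto
  have small8: "8 * (cmod \<omega>)\<^sup>2 * Linf_norm q \<le> 1"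
    using wQ\<epsilon> \<epsilon> unfolding w_def Q_def by linarith
  define g where "g = wderiv2 u1"
  have gL: "g \<in> L2" unfolding g_def by (rule H2_diamond_primitive2(2)[OF u1])
  obtain a where a: "AE x in D. u1 x = primitive2 a g x"
    unfolding g_def using H2_diamond_primitive2(3)[OF u1] by blast
  define G where "G = (LINT x|D. cmod (g x))"
  have G0: "0 \<le> G" by (simp add: G_def)
  define S where "S = cmod a + G"
  have S0: "0 \<le> S" using G0 by (simp add: S_def)
  have uS: "AE x in D. cmod (u1 x) \<le> S * x"
    using a AE_D_bounds by eventually_elim (use primitive2_linear_bound(2)[OF gL] in \<open>auto simp: S_def G_def\<close>)
  have ua: "AE x in D. cmod (u1 x - a * of_real x) \<le> G * x"
    using a AE_D_bounds by eventually_elim (use primitive2_linear_bound(1)[OF gL] in \<open>auto simp: G_def\<close>)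
  have "G \<le> w * (Q + Linf_norm \<chi>1 * mass) * S"
    using second_derivative_bound[OF S0 uS] by (simp add: G_def g_def w_def Q_def)
  also have "\<dots> \<le> \<epsilon> * S"
    unfolding \<epsilon>_def
    by (intro mult_right_mono mult_left_mono add_left_mono mult_mono S0 w0 massR mass_nonneg)
      (use m M m0 in \<open>auto simp: m_def\<close>)
  finally have G\<epsilon>: "G \<le> \<epsilon> * S" .
  \<comment> \<open>From G at most \<epsilon> (|a| + G), half of G is absorbed into the left-hand
    side.\<close>
  have G: "G \<le> 2 * \<epsilon> * cmod a"
  proof -
    have "\<epsilon> * G \<le> 1 / 2 * G" using \<epsilon> G0 by (intro mult_right_mono) auto
    then show ?thesis using G\<epsilon> by (simp add: S_def algebra_simps)
  qed
  have Ga: "G \<le> cmod a"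
  proof -
    have "2 * \<epsilon> * cmod a \<le> 1 * cmod a" using \<epsilon> by (intro mult_right_mono) auto
    then show ?thesis using G by simp
  qed
  have W: "weight \<le> m * (4 * (cmod a)\<^sup>2)"
  proof -
    have "S\<^sup>2 \<le> (2 * cmod a)\<^sup>2" using Ga S0 by (intro power_mono) (auto simp: S_def)
    then have "m * S\<^sup>2 \<le> m * (4 * (cmod a)\<^sup>2)" using m by (simp add: power_mult_distrib)
    then show ?thesis using weight_le[OF S0 uS] by (simp add: m_def)
  qed
  have mass: "mass \<le> 2 * w * weight" using mass_bound[OF small8] by (simp add: w_def)
  let ?I = "LINT x|D. of_real (\<chi>2 x) * (u1 x)\<^sup>2"
  have ui: "integrable D (\<lambda>x. of_real (\<chi>2 x) * (u1 x)\<^sup>2)"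
    using Linf_mult_integrable[OF \<chi>2 L2_mult_integrable[OF u1_L2 u1_L2]] by (simp add: power2_eq_square)
  have "cmod ?I \<le> 4 * Q * mass" using moment_bound by (simp add: Q_def)
  also have "\<dots> \<le> 4 * Q * (2 * w * (m * (4 * (cmod a)\<^sup>2)))"
    using mass W Q w0 by (intro mult_left_mono order_trans[OF mass]) auto
  also have "\<dots> = 32 * (w * Q * m) * (cmod a)\<^sup>2" by (simp add: algebra_simps)
  also have "\<dots> \<le> 32 * (\<kappa> / 50) * (cmod a)\<^sup>2"
  proof -
    have "w * Q * m \<le> \<epsilon> * m" using wQ\<epsilon> m by (intro mult_right_mono) auto
    then have "w * Q * m \<le> \<kappa> / 50" using \<epsilon>m by linarith
    then show ?thesis by (intro mult_right_mono mult_left_mono) auto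
  qed
  finally have I1: "cmod ?I \<le> 32 / 50 * \<kappa> * (cmod a)\<^sup>2" by simp
  have ai: "integrable D (\<lambda>x. a\<^sup>2 * of_real (\<chi>2 x * x\<^sup>2))"
    using second_moment(1)[OF \<chi>2 \<chi>2_pos] by (intro integrable_mult_right integrable_of_real)
  have "cmod (?I - a\<^sup>2 * of_real \<kappa>) = cmod (LINT x|D. of_real (\<chi>2 x) * (u1 x)\<^sup>2 - a\<^sup>2 * of_real (\<chi>2 x * x\<^sup>2))"
  proof -
    have "(LINT x|D. a\<^sup>2 * of_real (\<chi>2 x * x\<^sup>2)) = a\<^sup>2 * of_real \<kappa>"
      unfolding \<kappa>_def integral_of_real[OF second_moment(1)[OF \<chi>2 \<chi>2_pos], symmetric] by (rule integral_mult_right_zero)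
    then show ?thesis by (simp only: Bochner_Integration.integral_diff[OF ui ai])
  qed
  also have "\<dots> \<le> (LINT x|D. cmod (of_real (\<chi>2 x) * (u1 x)\<^sup>2 - a\<^sup>2 * of_real (\<chi>2 x * x\<^sup>2)))"
    by (rule integral_norm_bound)
  \<comment> \<open>The difference of squares factors: u1 - a x is at most |a| x / 25 and u1 + a x
    at most 3 |a| x in modulus, and 3/25 = 6/50.\<close>
  also have "\<dots> \<le> (LINT x|D. 6 / 50 * (cmod a)\<^sup>2 * (\<chi>2 x * x\<^sup>2))"
  proof (rule integral_mono_AE)
    show "integrable D (\<lambda>x. cmod (of_real (\<chi>2 x) * (u1 x)\<^sup>2 - a\<^sup>2 * of_real (\<chi>2 x * x\<^sup>2)))"
      using ui ai by (intro integrable_norm Bochner_Integration.integrable_diff)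
    show "integrable D (\<lambda>x. 6 / 50 * (cmod a)\<^sup>2 * (\<chi>2 x * x\<^sup>2))"
      by (intro integrable_mult_right second_moment(1)[OF \<chi>2 \<chi>2_pos])
    show "AE x in D. cmod (of_real (\<chi>2 x) * (u1 x)\<^sup>2 - a\<^sup>2 * of_real (\<chi>2 x * x\<^sup>2)) \<le> 6 / 50 * (cmod a)\<^sup>2 * (\<chi>2 x * x\<^sup>2)"
      using uS ua \<chi>2_pos AE_D_bounds
    proof eventually_elim
      case (elim x)
      have "of_real (\<chi>2 x) * (u1 x)\<^sup>2 - a\<^sup>2 * of_real (\<chi>2 x * x\<^sup>2)
          = of_real (\<chi>2 x) * ((u1 x - a * of_real x) * (u1 x + a * of_real x))"
        by (simp add: power2_eq_square algebra_simps)
      then have "cmod (of_real (\<chi>2 x) * (u1 x)\<^sup>2 - a\<^sup>2 * of_real (\<chi>2 x * x\<^sup>2))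
          = \<chi>2 x * (cmod (u1 x - a * of_real x) * cmod (u1 x + a * of_real x))"
        using elim by (simp add: norm_mult)
      also have "\<dots> \<le> \<chi>2 x * ((1 / 25 * cmod a * x) * (3 * cmod a * x))"
      proof (intro mult_left_mono mult_mono)
        have "2 * \<epsilon> * cmod a \<le> 1 / 25 * cmod a" using \<epsilon> by (intro mult_right_mono) auto
        then have "G * x \<le> 1 / 25 * cmod a * x" using G elim by (intro mult_right_mono) auto
        then show "cmod (u1 x - a * of_real x) \<le> 1 / 25 * cmod a * x" using elim by linarith
        have "S * x \<le> 2 * cmod a * x" using Ga elim by (intro mult_right_mono) (auto simp: S_def)
        moreover have "cmod (u1 x + a * of_real x) \<le> cmod (u1 x) + cmod a * x"
          using norm_triangle_ineq[of "u1 x" "a * of_real x"] elim by (simp add: norm_mult)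
        ultimately show "cmod (u1 x + a * of_real x) \<le> 3 * cmod a * x" using elim by linarith
      qed (use elim in auto)
      also have "\<dots> = 6 / 50 * (cmod a)\<^sup>2 * (\<chi>2 x * x\<^sup>2)" by (simp add: power2_eq_square)
      finally show ?case .
    qed
  qed
  also have "\<dots> = 6 / 50 * \<kappa> * (cmod a)\<^sup>2" by (simp add: \<kappa>_def)
  finally have I2: "cmod (?I - a\<^sup>2 * of_real \<kappa>) \<le> 6 / 50 * \<kappa> * (cmod a)\<^sup>2" .
  have "(cmod a)\<^sup>2 * \<kappa> = cmod (a\<^sup>2 * of_real \<kappa>)" using \<kappa> by (simp add: norm_mult norm_power)
  also have "\<dots> \<le> cmod ?I + cmod (?I - a\<^sup>2 * of_real \<kappa>)"
    using norm_triangle_ineq4[of ?I "?I - a\<^sup>2 * of_real \<kappa>"] by simp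
  \<comment> \<open>The shares 32/50 from the second equation and 6/50 from the first add up to less
    than 1; this is what the constant 50 secures.\<close>
  finally have "\<kappa> * (cmod a)\<^sup>2 \<le> 38 / 50 * (\<kappa> * (cmod a)\<^sup>2)" using I1 I2 by (simp add: algebra_simps)
  then have "\<kappa> * (cmod a)\<^sup>2 \<le> 0" by simp
  then have "a = 0" using \<kappa> by (simp add: mult_le_0_iff)
  then have "weight = 0" using W weight_nonneg by simp
  then show ?thesis by (rule X_zero_if_weight_zero[OF _ small8])
qed

end

section \<open>Assembly of the three claims\<close>

text \<open>Positivity of \<open>\<chi>2\<close> makes M positive, so the quotient in the hypothesis
  is genuine and can be cleared of its denominator.\<close>

lemma nonzero_operator_complex:
  assumes q: "q \<in> Linf" and \<chi>1: "\<chi>1 \<in> Linf" and \<chi>2: "\<chi>2 \<in> Linf" "AE x in D. 0 < \<chi>2 x"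
    and u: "u \<in> X_diamond" "\<not> X_zero u" and M: "M = Linf_norm \<chi>1 + Linf_norm \<chi>2"
    and \<omega>: "0 < (cmod \<omega>)\<^sup>2"
    and small: "(cmod \<omega>)\<^sup>2 \<le> (LINT x|D. \<chi>2 x * x\<^sup>2) / (50 * (Linf_norm q + 1)) / (M * (1 + M * X_norm u))"
  shows "\<not> X_zero (T_diamond q \<chi>1 \<chi>2 \<omega> u)"
proof
  assume zero: "X_zero (T_diamond q \<chi>1 \<chi>2 \<omega> u)"
  obtain u1 u2 where u12: "u = (u1, u2)" by (cases u)
  interpret T_zero q \<chi>1 \<chi>2 \<omega> u1 u2
    by unfold_locales (use q \<chi>1 \<chi>2 u zero \<omega> in \<open>auto simp: u12 X_diamond_def\<close>)
  have "0 < M" using second_moment[OF \<chi>2 \<chi>2_pos] Linf_norm_nonneg[OF \<chi>1] by (simp add: M)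
  moreover have "0 \<le> X_norm u" using mass_le_X_norm mass_nonneg by (simp add: u12)
  ultimately have "0 < M * (1 + M * X_norm u)" by (intro mult_pos_pos add_pos_nonneg) auto
  then have "(cmod \<omega>)\<^sup>2 * (M * (1 + M * X_norm u)) \<le> (LINT x|D. \<chi>2 x * x\<^sup>2) / (50 * (Linf_norm q + 1))"
    using small by (simp only: pos_le_divide_eq)
  then show False using X_zero_complex_small[OF _ M, of "X_norm u"] u(2) by (simp add: u12)
qed

theorem theorem2p9:
  shows
    "(\<forall>\<chi>2 Q. \<chi>2 \<in> Linf \<and> (AE x in D. 0 < \<chi>2 x) \<and> 0 < Q \<longrightarrow>
        (\<exists>c>0. \<forall>\<chi>1 q M. \<chi>1 \<in> Linf \<and> M = Linf_norm \<chi>1 + Linf_norm \<chi>2 \<and>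
            q \<in> C1_unit \<and> Linf_norm q = Q \<longrightarrow>
          (\<forall>u\<in>X_diamond. \<forall>\<omega>::complex. \<not> X_zero u \<and>
              0 < (cmod \<omega>)\<^sup>2 \<and> (cmod \<omega>)\<^sup>2 \<le> c / (M * (1 + M * X_norm u)) \<longrightarrow>
            \<not> X_zero (T_diamond q \<chi>1 \<chi>2 \<omega> u))))
   \<and> (\<forall>\<chi>2 Q M r. \<chi>2 \<in> Linf \<and> (AE x in D. 0 < \<chi>2 x) \<and> 0 < Q \<and> 0 < r \<longrightarrow>
        (\<exists>\<delta>>0. \<forall>\<chi>1 q. \<chi>1 \<in> Linf \<and> M = Linf_norm \<chi>1 + Linf_norm \<chi>2 \<and>
            q \<in> C1_unit \<and> Linf_norm q = Q \<longrightarrow>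
          (\<forall>u\<in>X_diamond. \<forall>\<omega>::complex.
              0 < cmod \<omega> \<and> cmod \<omega> < \<delta> \<and> 0 < X_norm u \<and> X_norm u < r \<longrightarrow>
            \<not> X_zero (T_diamond q \<chi>1 \<chi>2 \<omega> u))))
   \<and> (\<forall>q. q \<in> Linf \<longrightarrow>
        (\<exists>\<delta>>0. ((AE x in D. q x = 1) \<longrightarrow> \<delta> = pi / 2) \<and>
          (\<forall>\<chi>1 \<chi>2. \<chi>1 \<in> Linf \<and> \<chi>2 \<in> Linf \<and> (AE x in D. 0 < \<chi>2 x) \<longrightarrow>
            (\<forall>u\<in>X_diamond. \<forall>\<omega>::real. \<not> X_zero u \<and> (AE x in D. fst u x \<in> \<real>) \<and>
                0 < \<omega> \<and> \<omega> \<le> \<delta> \<longrightarrow>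
              \<not> X_zero (T_diamond q \<chi>1 \<chi>2 (complex_of_real \<omega>) u)))))"
proof (intro conjI allI impI)
  fix \<chi>2 :: "real \<Rightarrow> real" and Q :: real
  assume A: "\<chi>2 \<in> Linf \<and> (AE x in D. 0 < \<chi>2 x) \<and> 0 < Q"
  show "\<exists>c>0. \<forall>\<chi>1 q M. \<chi>1 \<in> Linf \<and> M = Linf_norm \<chi>1 + Linf_norm \<chi>2 \<and>
            q \<in> C1_unit \<and> Linf_norm q = Q \<longrightarrow>
          (\<forall>u\<in>X_diamond. \<forall>\<omega>::complex. \<not> X_zero u \<and>
              0 < (cmod \<omega>)\<^sup>2 \<and> (cmod \<omega>)\<^sup>2 \<le> c / (M * (1 + M * X_norm u)) \<longrightarrow>
            \<not> X_zero (T_diamond q \<chi>1 \<chi>2 \<omega> u))"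
  proof (intro exI[of _ "(LINT x|D. \<chi>2 x * x\<^sup>2) / (50 * (Q + 1))"] conjI allI impI ballI)
    show "0 < (LINT x|D. \<chi>2 x * x\<^sup>2) / (50 * (Q + 1))"
      using A second_moment(2)[of \<chi>2] by (intro divide_pos_pos) auto
    fix \<chi>1 q M u and \<omega> :: complex
    assume B: "\<chi>1 \<in> Linf \<and> M = Linf_norm \<chi>1 + Linf_norm \<chi>2 \<and> q \<in> C1_unit \<and> Linf_norm q = Q"
      and u: "u \<in> X_diamond"
      and C: "\<not> X_zero u \<and> 0 < (cmod \<omega>)\<^sup>2 \<and>
        (cmod \<omega>)\<^sup>2 \<le> (LINT x|D. \<chi>2 x * x\<^sup>2) / (50 * (Q + 1)) / (M * (1 + M * X_norm u))"
    show "\<not> X_zero (T_diamond q \<chi>1 \<chi>2 \<omega> u)"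
      by (rule nonzero_operator_complex[where M = M]) (use A B C u C1_unit_Linf in blast)+
  qed
next
  fix \<chi>2 :: "real \<Rightarrow> real" and Q M r :: real
  assume A: "\<chi>2 \<in> Linf \<and> (AE x in D. 0 < \<chi>2 x) \<and> 0 < Q \<and> 0 < r"
  define c where "c = (LINT x|D. \<chi>2 x * x\<^sup>2) / (50 * (Q + 1))"
  have c: "0 < c" using A second_moment[of \<chi>2] by (simp add: c_def)
  show "\<exists>\<delta>>0. \<forall>\<chi>1 q. \<chi>1 \<in> Linf \<and> M = Linf_norm \<chi>1 + Linf_norm \<chi>2 \<and>
            q \<in> C1_unit \<and> Linf_norm q = Q \<longrightarrow>
          (\<forall>u\<in>X_diamond. \<forall>\<omega>::complex.
              0 < cmod \<omega> \<and> cmod \<omega> < \<delta> \<and> 0 < X_norm u \<and> X_norm u < r \<longrightarrow>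
            \<not> X_zero (T_diamond q \<chi>1 \<chi>2 \<omega> u))"
  proof (cases "0 < M")
    case True
    \<comment> \<open>The bound of the first claim decreases in the norm, so its value at r serves
      all smaller norms; it limits the square of |\<omega>|, hence the root below.\<close>
    define d where "d = c / (M * (1 + M * r))"
    have d: "0 < d" using c True A by (auto simp: d_def intro!: divide_pos_pos mult_pos_pos add_pos_pos)
    show ?thesis
    proof (intro exI[of _ "sqrt d"] conjI allI impI ballI)
      fix \<chi>1 q u and \<omega> :: complex
      assume B: "\<chi>1 \<in> Linf \<and> M = Linf_norm \<chi>1 + Linf_norm \<chi>2 \<and> q \<in> C1_unit \<and> Linf_norm q = Q"
        and u: "u \<in> X_diamond"
        and C: "0 < cmod \<omega> \<and> cmod \<omega> < sqrt d \<and> 0 < X_norm u \<and> X_norm u < r"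
      have "(cmod \<omega>)\<^sup>2 \<le> (sqrt d)\<^sup>2" using C by (intro power_mono) auto
      also have "\<dots> = d" using d by simp
      also have "\<dots> \<le> c / (M * (1 + M * X_norm u))"
        unfolding d_def using True C c by (intro divide_left_mono mult_left_mono add_left_mono mult_pos_pos add_pos_pos) auto
      finally have "(cmod \<omega>)\<^sup>2 \<le> c / (M * (1 + M * X_norm u))" .
      moreover have "\<not> X_zero u" using X_norm_zero[OF u] C by auto
      ultimately show "\<not> X_zero (T_diamond q \<chi>1 \<chi>2 \<omega> u)"
        using A B C u C1_unit_Linf[of q] by (intro nonzero_operator_complex[where M = M]) (simp_all add: c_def)
    qed (use d in simp)
  next
    case False
    \<comment> \<open>For such M no \<open>\<chi>1\<close> qualifies, as the norm of
      \<open>\<chi>2\<close> is positive; the value of \<delta> is then arbitrary.\<close>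
    have "M \<noteq> Linf_norm \<chi>1 + Linf_norm \<chi>2" if "\<chi>1 \<in> Linf" for \<chi>1
      using False second_moment[of \<chi>2] A Linf_norm_nonneg[OF that] by auto
    then show ?thesis by (intro exI[of _ 1]) auto
  qed
next
  fix q :: "real \<Rightarrow> real"
  assume q: "q \<in> Linf"
  \<comment> \<open>The second value gives 16 t^2 (Q + 1) at most 1, hence 8 t^2 Q below 1; adding 1
    to Q covers q = 0.\<close>
  define \<delta> where "\<delta> = (if AE x in D. q x = 1 then pi / 2 else 1 / (4 * sqrt (Linf_norm q + 1)))"
  have Q: "0 \<le> Linf_norm q" by (rule Linf_norm_nonneg[OF q])
  show "\<exists>\<delta>>0. ((AE x in D. q x = 1) \<longrightarrow> \<delta> = pi / 2) \<and>
          (\<forall>\<chi>1 \<chi>2. \<chi>1 \<in> Linf \<and> \<chi>2 \<in> Linf \<and> (AE x in D. 0 < \<chi>2 x) \<longrightarrow>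
            (\<forall>u\<in>X_diamond. \<forall>\<omega>::real. \<not> X_zero u \<and> (AE x in D. fst u x \<in> \<real>) \<and>
                0 < \<omega> \<and> \<omega> \<le> \<delta> \<longrightarrow>
              \<not> X_zero (T_diamond q \<chi>1 \<chi>2 (complex_of_real \<omega>) u)))"
  proof (intro exI[of _ \<delta>] conjI allI impI ballI)
    show "0 < \<delta>" using Q by (simp add: \<delta>_def)
    show "\<delta> = pi / 2" if "AE x in D. q x = 1" using that by (simp add: \<delta>_def)
    fix \<chi>1 \<chi>2 u and t :: real
    assume \<chi>: "\<chi>1 \<in> Linf \<and> \<chi>2 \<in> Linf \<and> (AE x in D. 0 < \<chi>2 x)" and u: "u \<in> X_diamond"
      and t: "\<not> X_zero u \<and> (AE x in D. fst u x \<in> \<real>) \<and> 0 < t \<and> t \<le> \<delta>"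
    obtain u1 u2 where u12: "u = (u1, u2)" by (cases u)
    show "\<not> X_zero (T_diamond q \<chi>1 \<chi>2 (complex_of_real t) u)"
    proof
      assume zero: "X_zero (T_diamond q \<chi>1 \<chi>2 (complex_of_real t) u)"
      interpret T_zero q \<chi>1 \<chi>2 "complex_of_real t" u1 u2
        by unfold_locales (use q \<chi> u zero t in \<open>auto simp: u12 X_diamond_def\<close>)
      have real: "AE x in D. u1 x \<in> \<real>" using t by (simp add: u12)
      show False
      proof (cases "AE x in D. q x = 1")
        case True
        then show False using X_zero_real_one[OF real True refl] t by (simp add: \<delta>_def u12)
      next
        case False
        have "t\<^sup>2 \<le> (1 / (4 * sqrt (Linf_norm q + 1)))\<^sup>2"
          using t False by (intro power_mono) (auto simp: \<delta>_def)
        also have "\<dots> = 1 / (16 * (Linf_norm q + 1))"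
          using Q by (simp add: power_divide power_mult_distrib)
        finally have "t\<^sup>2 * (16 * (Linf_norm q + 1)) \<le> 1"
          using Q by (simp add: pos_le_divide_eq)
        moreover have "0 < t\<^sup>2" using t by simp
        moreover have "0 \<le> t\<^sup>2 * Linf_norm q" using Q by simp
        moreover have "t\<^sup>2 * (16 * (Linf_norm q + 1)) = 16 * t\<^sup>2 + 16 * (t\<^sup>2 * Linf_norm q)"
          "8 * t\<^sup>2 * Linf_norm q = 8 * (t\<^sup>2 * Linf_norm q)"
          by (simp_all add: algebra_simps)
        ultimately have "8 * t\<^sup>2 * Linf_norm q < 1" by linarith
        then have "X_zero (u1, u2)" by (intro X_zero_real_small[OF real]) simp
        then show False using t by (simp add: u12)
      qed
    qed
  qed
qed

end
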